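(* Let $\mathcal{A}$ be a finite or countably infinite linearly ordered alphabet and let $(M,\mu)$ be an EPRI Markov chain with state set $\mathcal{A}$. For each $n \geqslant 0$, let $w$ be a random word of length $n$ whose letters are generated by $(M,\mu)$, either from left to right or from right to left (the same direction for all $n$). Then for every integer $k \geqslant 0$ there exist a constant $\gamma_k$ and a sequence $(\varepsilon_n)_{n \geqslant 0}$ tending to $0$ such that \[\mathbb{P}\left[\left|\frac{|\mathsf{is}^k(w)|}{|w|} - \gamma_k\right| \geqslant \varepsilon_{|w|}\right] \leqslant \varepsilon_{|w|}.\]
   Context: Words are indexed from $0$: $w = w_0 \cdots w_{|w|-1}$, and $w_{i \cdots j} = w_i \cdots w_j$. A sentinel letter $\$ \notin \mathcal{A}$ is smaller than every letter of $\mathcal{A}$, and $w_{|w|} = \$$. An integer $i \leqslant |w|-1$ is $w$-non-decreasing if there is $j$ with $i+1 \leqslant j \leqslant |w|-1$ and $w_i = \cdots = w_{j-1} < w_j$; it is $w$-locally minimal if moreover $i \geqslant 1$ and $w_{i-1} > w_i$. If $i_0 < \cdots < i_{k-1}$ are the $w$-locally minimal integers and $i_k = |w|$, the unimodal factors of $w$ are $w_{i_0 \cdots i_1}, \ldots, w_{i_{k-1} \cdots i_k}$; $\mathsf{eis}(w)$ is the length-$k$ word over the lexicographically ordered alphabet $\mathcal{A}^+\cdot(\varepsilon+\$)$ whose letters are these factors in order; $\mathsf{is}(w)$ is obtained from $\mathsf{eis}(w)$ by replacing each letter by its rank (from $0$) among the distinct letters of $\mathsf{eis}(w)$; $\mathsf{is}^0(w)=w$,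 $\mathsf{is}^{k+1}(w) = \mathsf{is}(\mathsf{is}^k(w))$. A Markov chain $(M,\mu)$ with countable state set $\mathcal{S}$ has initial distribution $\mu$ and transition matrix $M$ ($\sum_t M(s,t) = 1$); a trajectory $(X_n)_{n\geqslant 0}$ satisfies $\mathbb{P}(X_0 = x) = \mu(x)$ and $\mathbb{P}(X_n = x_n \mid X_0=x_0,\ldots,X_{n-1}=x_{n-1}) = M(x_{n-1},x_n)$. Its underlying graph has vertex set $\mathcal{S}$ and an edge $(s,t)$ whenever $M(s,t)>0$. For a distribution $\nu$, $(M\nu)(x) = \sum_y M(y,x)\nu(y)$; $\nu$ is stationary if $M\nu = \nu$. The chain is EPRI if there is a set $\mathcal{X} \subseteq \mathcal{S}$ (its terminal component) such that (i) $\mathcal{X}$ is a strongly connected component of the underlying graph; (ii) $M$ has a stationary distribution that is positive on $\mathcal{X}$ and zero on $\mathcal{S}\setminus\mathcal{X}$; (iii) for every initial distribution, a trajectory almost surely visits some state of $\mathcal{X}$. The letters of a word $w$ of length $n$ are generated by $(M,\mu)$ from left to right if $w_k = X_k$ for $0 \leqslant k < n$, and from right to left if $w_{n-1-k} = X_k$ for $0 \leqslant k < n$, where $(X_k)$ is a trajectory of $(M,\mu)$. *)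

theory Defs
  imports "HOL-Probability.Probability" "HOL-Library.List_Lexorder" "HOL-Library.Option_ord"
begin

definition non_decreasing_at :: "'a::linorder list \<Rightarrow> nat \<Rightarrow> bool" where
  "non_decreasing_at w i \<longleftrightarrow>
     (\<exists>j. i + 1 \<le> j \<and> j < length w \<and> (\<forall>m\<in>{i..j-1}. w ! m = w ! i) \<and> w ! (j-1) < w ! j)"

definition locally_minimal :: "'a::linorder list \<Rightarrow> nat \<Rightarrow> bool" where
  "locally_minimal w i \<longleftrightarrow> non_decreasing_at w i \<and> i \<ge> 1 \<and> w ! (i-1) > w ! i"

text \<open>The sentinel is \<^term>\<open>None\<close>, which is the least element in the order of
  \<^theory>\<open>HOL-Library.Option_ord\<close>; lists of such letters are ordered lexicographically,
  a proper prefix being smaller.\<close>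

definition with_sentinel :: "'a list \<Rightarrow> 'a option list" where
  "with_sentinel w = map Some w @ [None]"

text \<open>Both end points are included, so consecutive unimodal factors share a letter.\<close>

definition factor :: "'a list \<Rightarrow> nat \<Rightarrow> nat \<Rightarrow> 'a option list" where
  "factor w i j = map (\<lambda>m. with_sentinel w ! m) [i..<j+1]"

definition eis :: "'a::linorder list \<Rightarrow> 'a option list list" where
  "eis w =
     (let ps = sorted_list_of_set {i. locally_minimal w i}; qs = ps @ [length w]
      in map (\<lambda>m. factor w (qs ! m) (qs ! (m+1))) [0..<length ps])"

definition is_word :: "'a::linorder list \<Rightarrow> nat list" where
  "is_word w = map (\<lambda>u. card {v \<in> set (eis w). v < u}) (eis w)"

text \<open>Only the zeroth iterate is a word over \<^typ>\<open>'a\<close>, all later ones are words over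
  \<^typ>\<open>nat\<close>; hence the length of the iterate is defined instead of the iterate itself.\<close>

definition length_is_iter :: "nat \<Rightarrow> 'a::linorder list \<Rightarrow> nat" where
  "length_is_iter k w =
     (case k of 0 \<Rightarrow> length w | Suc l \<Rightarrow> length ((is_word ^^ l) (is_word w)))"

text \<open>A transition matrix is a map from states to distributions, with entry
  \<open>pmf (M s) t\<close> at \<open>(s, t)\<close>. The conditional probabilities are prescribed only for
  conditioning events of positive probability.\<close>

definition trajectory ::
  "('a \<Rightarrow> 'a pmf) \<Rightarrow> 'a pmf \<Rightarrow> 'b measure \<Rightarrow> (nat \<Rightarrow> 'b \<Rightarrow> 'a) \<Rightarrow> bool" where
  "trajectory M \<mu> \<Omega> X \<longleftrightarrow>
     prob_space \<Omega> \<and>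
     (\<forall>n. X n \<in> measurable \<Omega> (count_space UNIV)) \<and>
     (\<forall>x. \<P>(\<omega> in \<Omega>. X 0 \<omega> = x) = pmf \<mu> x) \<and>
     (\<forall>n\<ge>1. \<forall>x. \<P>(\<omega> in \<Omega>. \<forall>k<n. X k \<omega> = x k) > 0 \<longrightarrow>
        \<P>(\<omega> in \<Omega>. X n \<omega> = x n \<bar> \<forall>k<n. X k \<omega> = x k) = pmf (M (x (n-1))) (x n))"

definition edges :: "('a \<Rightarrow> 'a pmf) \<Rightarrow> 'a rel" where
  "edges M = {(s, t). pmf (M s) t > 0}"

definition strongly_connected_component :: "'a rel \<Rightarrow> 'a set \<Rightarrow> bool" where
  "strongly_connected_component E C \<longleftrightarrow>
     C \<in> UNIV // {(s, t). (s, t) \<in> E\<^sup>* \<and> (t, s) \<in> E\<^sup>*}"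

definition stationary :: "('a \<Rightarrow> 'a pmf) \<Rightarrow> 'a pmf \<Rightarrow> bool" where
  "stationary M \<nu> \<longleftrightarrow> (\<forall>x. (\<Sum>\<^sub>\<infinity>y. pmf (M y) x * pmf \<nu> y) = pmf \<nu> x)"

text \<open>A definition cannot quantify over all types of sample spaces. Sample spaces of
  sequences of states suffice: the process of any trajectory has a law there, under which
  the coordinate process is a trajectory, and such laws exist by the Ionescu-Tulcea theorem.\<close>

definition EPRI_with :: "('a \<Rightarrow> 'a pmf) \<Rightarrow> 'a set \<Rightarrow> bool" where
  "EPRI_with M C \<longleftrightarrow>
     strongly_connected_component (edges M) C \<and>
     (\<exists>\<nu>. stationary M \<nu> \<and> (\<forall>x\<in>C. pmf \<nu> x > 0) \<and> (\<forall>x\<in>-C. pmf \<nu> x = 0)) \<and>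
     (\<forall>\<mu> (\<Omega> :: (nat \<Rightarrow> 'a) measure) X.
        trajectory M \<mu> \<Omega> X \<longrightarrow> (AE \<omega> in \<Omega>. \<exists>n. X n \<omega> \<in> C))"

definition EPRI :: "('a \<Rightarrow> 'a pmf) \<Rightarrow> bool" where
  "EPRI M \<longleftrightarrow> (\<exists>C. EPRI_with M C)"

definition generated_left_to_right :: "(nat \<Rightarrow> 'a) \<Rightarrow> nat \<Rightarrow> 'a list \<Rightarrow> bool" where
  "generated_left_to_right x n w \<longleftrightarrow> length w = n \<and> (\<forall>k<n. w ! k = x k)"

definition generated_right_to_left :: "(nat \<Rightarrow> 'a) \<Rightarrow> nat \<Rightarrow> 'a list \<Rightarrow> bool" where
  "generated_right_to_left x n w \<longleftrightarrow> length w = n \<and> (\<forall>k<n. w ! (n - 1 - k) = x k)"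

end

theory Submission
  imports Defs
begin

text \<open>
  Fix \<open>k\<close> and let \<open>F w\<close> be the length of the \<open>k\<close>-th iterate of \<open>w\<close>. Concatenating \<open>u\<close> and \<open>v\<close>
  changes only boundedly many unimodal factors around the border, and lengths of iterates depend
  only on the relative order of the letters; by induction on \<open>k\<close>, \<open>F (u @ v) - F u - F v\<close> is
  bounded. The same holds for \<open>F \<circ> rev\<close>, which settles the direction from right to left.

  For an almost additive \<open>F\<close> with \<open>0 \<le> F w \<le> |w|\<close>, let \<open>\<phi>\<^sub>n(x)\<close> be the expectation of
  \<open>F(X\<^sub>0\<dots>X\<^sub>n\<^sub>-\<^sub>1)/n\<close> for the chain started at \<open>x\<close>. Dropping the first or the last letter shows that every
  pointwise subsequential limit of \<open>\<phi>\<^sub>n\<close> is a bounded harmonic function, hence constant on the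
  terminal component; its value is the limit \<open>\<gamma>\<close> of the stationary means. So \<open>\<phi>\<^sub>n\<close> tends to \<open>\<gamma>\<close> in
  \<open>L\<^sup>1(\<nu>)\<close>. Cutting a word of length \<open>2n\<close> in two halves then makes the halves asymptotically
  uncorrelated, so the stationary mean square deviation \<open>V\<close> satisfies \<open>V\<^sub>2\<^sub>n \<le> V\<^sub>n/2 + o(1)\<close> and
  tends to \<open>0\<close>. An arbitrary initial distribution is handled by waiting until the chain has entered the
  terminal component, which changes \<open>F/n\<close> by \<open>o(1)\<close>; Chebyshev's inequality concludes.
\<close>

section \<open>Unimodal factors of a concatenation\<close>

definition consecutive :: "'a list \<Rightarrow> ('a \<times> 'a) list" where
  "consecutive xs = zip xs (tl xs)"

lemma consecutive_append:
  "consecutive (xs @ ys) =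
     consecutive xs @ (if xs = [] \<or> ys = [] then [] else [(last xs, hd ys)]) @ consecutive ys"
proof (induction xs)
  case (Cons x xs)
  then show ?case
    by (cases xs; cases ys) (auto simp: consecutive_def)
qed (simp add: consecutive_def)

lemma length_consecutive [simp]: "length (consecutive xs) = length xs - 1"
  by (simp add: consecutive_def)

lemma set_consecutive: "(a, b) \<in> set (consecutive xs) \<Longrightarrow> a \<in> set xs \<and> b \<in> set xs"
  unfolding consecutive_def by (cases xs) (auto dest: set_zip_leftD set_zip_rightD)

lemma consecutive_map: "consecutive (map f xs) = map (map_prod f f) (consecutive xs)"
  by (simp add: consecutive_def map_tl[symmetric] zip_map_map split_def map_prod_def)

lemma sorted_list_of_set_Un:
  fixes A B :: "'a::linorder set"
  assumes "finite A" "finite B" "\<And>a b. a \<in> A \<Longrightarrow> b \<in> B \<Longrightarrow> a < b"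
  shows "sorted_list_of_set (A \<union> B) = sorted_list_of_set A @ sorted_list_of_set B"
proof -
  have "A \<inter> B = {}" using assms(3) by fastforce
  then show ?thesis
    using assms by (intro sorted_distinct_set_unique)
      (auto simp: sorted_append intro!: less_imp_le)
qed

lemma sorted_list_of_set_plus:
  fixes A :: "nat set"
  assumes "finite A"
  shows "sorted_list_of_set ((+) k ` A) = map ((+) k) (sorted_list_of_set A)"
  using assms by (intro sorted_distinct_set_unique) (auto simp: sorted_map distinct_map)

text \<open>Pairs of neighbouring end points replace the indexed definition, so that splitting the
  list of end points splits the list of factors.\<close>

lemma eis_consecutive:
  "eis w = map (\<lambda>(i, j). factor w i j)
             (consecutive (sorted_list_of_set {i. locally_minimal w i} @ [length w]))"
  by (rule nth_equalityI) (auto simp: eis_def consecutive_def Let_def nth_tl)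

text \<open>Comparing \<open>w ! i\<close> itself with \<open>w ! j\<close> after a half-open run
  avoids \<open>j - 1\<close>, which is awkward under shifts and restrictions.\<close>

lemma non_decreasing_atE:
  assumes "non_decreasing_at w i"
  obtains j where "i < j" "j < length w" "\<And>m. i \<le> m \<Longrightarrow> m < j \<Longrightarrow> w ! m = w ! i" "w ! i < w ! j"
proof -
  obtain j where j: "i + 1 \<le> j" "j < length w" "\<forall>m\<in>{i..j-1}. w ! m = w ! i" "w ! (j-1) < w ! j"
    using assms unfolding non_decreasing_at_def by blast
  have *: "w ! m = w ! i" if "i \<le> m" "m < j" for m
    using bspec[OF j(3), of m] that by simp
  show thesis
  proof (rule that)
    show "w ! i < w ! j" using j(1,4) *[of "j - 1"] by simp
  qed (use j(1) in simp, fact j(2), fact *)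
qed

lemma non_decreasing_atI:
  assumes "i < j" "j < length w" "\<And>m. i \<le> m \<Longrightarrow> m < j \<Longrightarrow> w ! m = w ! i" "w ! i < w ! j"
  shows "non_decreasing_at w i"
proof -
  have "w ! (j - 1) < w ! j"
    using assms(1,4) assms(3)[of "j - 1"] by simp
  moreover have "\<forall>m\<in>{i..j-1}. w ! m = w ! i"
  proof
    fix m assume "m \<in> {i..j-1}"
    then show "w ! m = w ! i" using assms(1) by (intro assms(3)) auto
  qed
  moreover have "i + 1 \<le> j" using assms(1) by simp
  ultimately show ?thesis
    unfolding non_decreasing_at_def using assms(2) by blast
qed

lemma locally_minimal_less_length: "locally_minimal w i \<Longrightarrow> i < length w"
  unfolding locally_minimal_def by (blast elim: non_decreasing_atE intro: less_trans)

lemma finite_locally_minimal: "finite {i. locally_minimal w i}"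
  using locally_minimal_less_length by (rule_tac finite_subset[of _ "{..<length w}"]) auto

lemma length_eis_le: "length (eis w) \<le> length w"
proof -
  have "{i. locally_minimal w i} \<subseteq> {..<length w}"
    using locally_minimal_less_length by auto
  then have "card {i. locally_minimal w i} \<le> length w"
    by (metis card_lessThan card_mono finite_lessThan)
  then show ?thesis
    by (simp add: eis_consecutive)
qed

section \<open>Locally minimal positions of a concatenation\<close>

lemma non_decreasing_at_appendI:
  assumes "non_decreasing_at u i"
  shows "non_decreasing_at (u @ v) i"
proof -
  obtain j where j: "i < j" "j < length u" "\<And>m. i \<le> m \<Longrightarrow> m < j \<Longrightarrow> u ! m = u ! i" "u ! i < u ! j"
    using assms by (rule non_decreasing_atE) blast
  show ?thesis
  proof (rule non_decreasing_atI)
    show "(u @ v) ! m = (u @ v) ! i" if "i \<le> m" "m < j" for m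
      using j(1,2) j(3)[OF that] that by (simp add: nth_append)
  qed (use j(1,2,4) in \<open>simp_all add: nth_append\<close>)
qed

lemma locally_minimal_append_left: "locally_minimal u i \<Longrightarrow> locally_minimal (u @ v) i"
  using locally_minimal_less_length[of u i] non_decreasing_at_appendI[of u i v]
  by (auto simp: locally_minimal_def nth_append)

lemma non_decreasing_at_shift: "non_decreasing_at (u @ v) (length u + i) \<longleftrightarrow> non_decreasing_at v i"
proof
  assume "non_decreasing_at (u @ v) (length u + i)"
  then obtain j where j: "length u + i < j" "j < length (u @ v)"
    "\<And>m. length u + i \<le> m \<Longrightarrow> m < j \<Longrightarrow> (u @ v) ! m = (u @ v) ! (length u + i)"
    "(u @ v) ! (length u + i) < (u @ v) ! j"
    using non_decreasing_atE by blast
  show "non_decreasing_at v i"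
  proof (rule non_decreasing_atI)
    show "v ! m = v ! i" if "i \<le> m" "m < j - length u" for m
      using j(3)[of "length u + m"] that by simp
    show "v ! i < v ! (j - length u)"
      using j(1,4) by (simp add: nth_append)
  qed (use j(1,2) in auto)
next
  assume "non_decreasing_at v i"
  then obtain j where j: "i < j" "j < length v" "\<And>m. i \<le> m \<Longrightarrow> m < j \<Longrightarrow> v ! m = v ! i"
    "v ! i < v ! j"
    by (rule non_decreasing_atE) blast
  show "non_decreasing_at (u @ v) (length u + i)"
  proof (rule non_decreasing_atI)
    show "(u @ v) ! m = (u @ v) ! (length u + i)" if "length u + i \<le> m" "m < length u + j" for m
      using j(3)[of "m - length u"] that by (simp add: nth_append)
  qed (use j(1,2,4) in auto)
qed

text \<open>Position 0 of \<open>v\<close> is left out: it is never locally minimal in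
  \<open>v\<close>, but in \<open>u @ v\<close> it may acquire a larger left neighbour.\<close>

lemma locally_minimal_shift:
  assumes "i \<ge> 1"
  shows "locally_minimal (u @ v) (length u + i) \<longleftrightarrow> locally_minimal v i"
  using assms by (auto simp: locally_minimal_def non_decreasing_at_shift nth_append)

text \<open>The ascent that witnesses the property in \<open>u @ v\<close> must lie beyond
  \<open>u\<close>, since otherwise it would serve in \<open>u\<close> as well; up to that ascent
  the word is constant.\<close>

lemma non_decreasing_at_append_new:
  assumes "non_decreasing_at (u @ v) i" "\<not> non_decreasing_at u i" "i \<le> m" "m < length u"
  shows "u ! m = u ! i"
proof -
  obtain j where j: "i < j" "j < length (u @ v)"
    "\<And>m. i \<le> m \<Longrightarrow> m < j \<Longrightarrow> (u @ v) ! m = (u @ v) ! i" "(u @ v) ! i < (u @ v) ! j"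
    using assms(1) by (rule non_decreasing_atE) blast
  have *: "u ! n = u ! i" if "i \<le> n" "n < j" "n < length u" for n
    using j(3)[of n] that by (simp add: nth_append)
  have "j \<ge> length u"
  proof (rule ccontr)
    assume "\<not> j \<ge> length u"
    then have "non_decreasing_at u i"
      using j(1,4) by (intro non_decreasing_atI[of i j] *) (simp_all add: nth_append)
    then show False using assms(2) by simp
  qed
  then show ?thesis
    using assms(3,4) by (intro *) simp_all
qed

text \<open>Apart from the border position \<open>length u\<close>, a new minimum starts a constant
  run reaching the end of \<open>u\<close> and is preceded by a descent, so there is at most one.
  Old minima of \<open>u\<close> have a later ascent inside \<open>u\<close>, hence lie before the
  new ones.\<close>

lemma locally_minimal_append:
  obtains N where "{i. locally_minimal (u @ v) i} =
      {i. locally_minimal u i} \<union> N \<union> (+) (length u) ` {i. locally_minimal v i}"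
    "finite N" "card N \<le> 2"
    "\<And>i j. locally_minimal u i \<Longrightarrow> j \<in> N \<Longrightarrow> i < j" "\<And>j. j \<in> N \<Longrightarrow> j \<le> length u"
proof
  define N where "N = {i. i \<le> length u \<and> locally_minimal (u @ v) i \<and> \<not> locally_minimal u i}"
  define N' where "N' = {i \<in> N. i < length u}"
  have new: "u ! m = u ! i" if "i \<in> N" "i \<le> m" "m < length u" for i m
  proof (rule non_decreasing_at_append_new)
    show "non_decreasing_at (u @ v) i" "\<not> non_decreasing_at u i"
      using that by (auto simp: N_def locally_minimal_def nth_append split: if_splits)
  qed (use that in auto)
  show "{i. locally_minimal (u @ v) i} =
      {i. locally_minimal u i} \<union> N \<union> (+) (length u) ` {i. locally_minimal v i}" (is "?L = ?R")
  proof
    show "?L \<subseteq> ?R"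
    proof
      fix i assume i: "i \<in> ?L"
      show "i \<in> ?R"
      proof (cases "i \<le> length u")
        case False
        then have "locally_minimal v (i - length u)"
          using i locally_minimal_shift[of "i - length u" u v] by auto
        then have "i \<in> (+) (length u) ` {i. locally_minimal v i}"
          using False by (intro image_eqI[of _ _ "i - length u"]) auto
        then show ?thesis by blast
      qed (use i in \<open>auto simp: N_def\<close>)
    qed
    show "?R \<subseteq> ?L"
    proof -
      have "locally_minimal (u @ v) (length u + i)" if "locally_minimal v i" for i
        using that locally_minimal_shift[of i u v] by (auto simp: locally_minimal_def)
      then show ?thesis
        by (auto simp: N_def locally_minimal_append_left)
    qed
  qed
  \<comment> \<open>Two such positions would both lie in the constant run that ends
    \<open>u\<close>, which excludes the descent just before the larger one.\<close>
  have "i = j" if "i \<in> N'" "j \<in> N'" "i \<le> j" for i j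
  proof (rule ccontr)
    assume "i \<noteq> j"
    then have "u ! (j - 1) = u ! i" "u ! j = u ! i"
      using that new[of i "j - 1"] new[of i j] by (auto simp: N'_def)
    moreover have "u ! (j - 1) > u ! j"
      using that by (auto simp: N'_def N_def locally_minimal_def nth_append split: if_splits)
    ultimately show False by simp
  qed
  then have "is_singleton N' \<or> N' = {}"
    by (metis is_singletonI' nle_le)
  then have "card N' \<le> 1" "finite N'"
    by (auto simp: is_singleton_def)
  moreover have "N \<subseteq> insert (length u) N'"
    by (auto simp: N_def N'_def)
  ultimately have "card N \<le> card (insert (length u) N')"
    by (intro card_mono) auto
  also have "\<dots> \<le> 2"
    using \<open>card N' \<le> 1\<close> \<open>finite N'\<close> by (simp add: card_insert_if)
  finally show "card N \<le> 2" .
  show "finite N"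
    by (rule finite_subset[of _ "{..length u}"]) (auto simp: N_def)
  show "i < j" if i: "locally_minimal u i" and j: "j \<in> N" for i j
  proof (rule ccontr)
    assume "\<not> i < j"
    obtain k where k: "i < k" "k < length u" "u ! i < u ! k"
      using i unfolding locally_minimal_def by (blast elim: non_decreasing_atE)
    then have "u ! k = u ! j" "u ! i = u ! j"
      using new[OF j, of k] new[OF j, of i] \<open>\<not> i < j\<close> by simp_all
    then show False using k by simp
  qed
  show "j \<le> length u" if "j \<in> N" for j
    using that by (simp add: N_def)
qed

section \<open>Effect of a concatenation on the word of factors\<close>

lemma with_sentinel_nth:
  "i \<le> length w \<Longrightarrow> with_sentinel w ! i = (if i < length w then Some (w ! i) else None)"
  by (auto simp: with_sentinel_def nth_append)

lemma factor_append_left: "j < length u \<Longrightarrow> factor (u @ v) i j = factor u i j"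
  by (auto simp: factor_def with_sentinel_nth nth_append)

lemma factor_shift:
  assumes "j \<le> length v"
  shows "factor (u @ v) (length u + i) (length u + j) = factor v i j"
proof -
  have "[length u + i..<length u + j + 1] = map ((+) (length u)) [i..<j + 1]"
    by (rule nth_equalityI) (auto simp del: upt_Suc)
  then show ?thesis
    using assms by (auto simp: factor_def with_sentinel_nth nth_append)
qed

text \<open>Factors between two minima of \<open>u\<close> survive as \<open>E\<close>, and those of
  \<open>v\<close> survive up to a shift. Only the last factor of \<open>u\<close>, which ends with
  the sentinel, is lost (\<open>x\<close>). The new factors \<open>y\<close> start at the last
  minimum of \<open>u\<close> or at one of the at most two new minima, hence the bound 3.\<close>

lemma eis_append:
  obtains E x y where "eis u = E @ x" "eis (u @ v) = E @ y @ eis v" "length x \<le> 1" "length y \<le> 3"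
proof -
  define lm where "lm w = sorted_list_of_set {i. locally_minimal w i}" for w :: "'a list"
  have set_lm: "set (lm w) = {i. locally_minimal w i}" for w
    by (simp add: lm_def finite_locally_minimal)
  obtain N where N: "{i. locally_minimal (u @ v) i} =
      {i. locally_minimal u i} \<union> N \<union> (+) (length u) ` {i. locally_minimal v i}"
    "finite N" "card N \<le> 2"
    "\<And>i j. locally_minimal u i \<Longrightarrow> j \<in> N \<Longrightarrow> i < j" "\<And>j. j \<in> N \<Longrightarrow> j \<le> length u"
    using locally_minimal_append[of u v] by metis
  define ns where "ns = sorted_list_of_set N"
  have "length u + j > length u" if "locally_minimal v j" for j
    using that by (simp add: locally_minimal_def)
  then have "lm (u @ v) = sorted_list_of_set ({i. locally_minimal u i} \<union> N) @
      sorted_list_of_set ((+) (length u) ` {i. locally_minimal v i})"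
    unfolding lm_def N(1)
    using N(2,5) finite_locally_minimal[of u] finite_locally_minimal[of v]
      locally_minimal_less_length[of u]
    by (intro sorted_list_of_set_Un) fastforce+
  also have "sorted_list_of_set ({i. locally_minimal u i} \<union> N) = lm u @ ns"
    unfolding lm_def ns_def using N(2,4) finite_locally_minimal[of u]
    by (intro sorted_list_of_set_Un) auto
  finally have "lm (u @ v) = lm u @ ns @ map ((+) (length u)) (lm v)"
    by (simp add: sorted_list_of_set_plus finite_locally_minimal lm_def)
  then have uv: "lm (u @ v) @ [length (u @ v)] =
      lm u @ ns @ map ((+) (length u)) (lm v @ [length v])"
    by simp
  define E where "E = map (\<lambda>(i, j). factor u i j) (consecutive (lm u))"
  have E: "map (\<lambda>(i, j). factor (u @ v) i j) (consecutive (lm u)) = E"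
    unfolding E_def by (rule map_cong)
      (auto dest!: set_consecutive simp: set_lm factor_append_left locally_minimal_less_length)
  have eis_v: "map (\<lambda>(i, j). factor (u @ v) i j) (consecutive (map ((+) (length u)) (lm v @ [length v])))
      = eis v"
    unfolding eis_consecutive lm_def[symmetric] consecutive_map map_map
  proof (rule map_cong)
    fix p assume p: "p \<in> set (consecutive (lm v @ [length v]))"
    obtain i j where [simp]: "p = (i, j)" by (cases p)
    have "j \<le> length v"
      using p by (auto dest!: set_consecutive simp: set_lm intro: less_imp_le[OF locally_minimal_less_length])
    then show "((\<lambda>(i, j). factor (u @ v) i j) \<circ> map_prod ((+) (length u)) ((+) (length u))) p =
       (case p of (i, j) \<Rightarrow> factor v i j)"
      by (simp add: factor_shift)
  qed simp
  have len: "length ns \<le> 2"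
    using N by (simp add: ns_def)
  show thesis
  proof
    show "eis u = E @ map (\<lambda>(i, j). factor u i j) (if lm u = [] then [] else [(last (lm u), length u)])"
      by (simp add: eis_consecutive E_def lm_def[symmetric] consecutive_append) (simp add: consecutive_def)
    show "eis (u @ v) = E @ map (\<lambda>(i, j). factor (u @ v) i j)
        ((if lm u = [] then [] else [(last (lm u), hd (ns @ map ((+) (length u)) (lm v @ [length v])))])
         @ consecutive ns @ (if ns = [] then [] else [(last ns, hd (map ((+) (length u)) (lm v @ [length v])))]))
        @ eis v"
      unfolding eis_v[symmetric] E[symmetric]
      by (simp only: eis_consecutive lm_def[symmetric] uv) (simp add: consecutive_append)
  qed (use len in auto)
qed

section \<open>Order isomorphisms and almost additivity\<close>

lemma locally_minimal_map:
  assumes "strict_mono_on (set w) f"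
  shows "locally_minimal (map f w) i \<longleftrightarrow> locally_minimal w i"
proof (cases "i < length w")
  case True
  have less: "map f w ! a < map f w ! b \<longleftrightarrow> w ! a < w ! b" if "a < length w" "b < length w" for a b
    using that strict_mono_on_less[OF assms] by simp
  have eq: "map f w ! a = map f w ! b \<longleftrightarrow> w ! a = w ! b" if "a < length w" "b < length w" for a b
    using that strict_mono_on_eq[OF assms] by simp
  have "non_decreasing_at (map f w) i \<longleftrightarrow> non_decreasing_at w i"
  proof
    assume "non_decreasing_at (map f w) i"
    then obtain j where j: "i < j" "j < length (map f w)"
      "\<And>m. i \<le> m \<Longrightarrow> m < j \<Longrightarrow> map f w ! m = map f w ! i" "map f w ! i < map f w ! j"
      by (rule non_decreasing_atE) blast
    show "non_decreasing_at w i"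
    proof (rule non_decreasing_atI)
      show "w ! m = w ! i" if "i \<le> m" "m < j" for m
        using j(2) j(3)[OF that] eq[of m i] that by simp
    qed (use j(1,2,4) less[of i j] in auto)
  next
    assume "non_decreasing_at w i"
    then obtain j where j: "i < j" "j < length w"
      "\<And>m. i \<le> m \<Longrightarrow> m < j \<Longrightarrow> w ! m = w ! i" "w ! i < w ! j"
      by (rule non_decreasing_atE) blast
    show "non_decreasing_at (map f w) i"
    proof (rule non_decreasing_atI)
      show "map f w ! m = map f w ! i" if "i \<le> m" "m < j" for m
        using j(2) j(3)[OF that] that by simp
    qed (use j(1,2,4) less[of i j] in auto)
  qed
  then show ?thesis
    using True less[of i "i - 1"] by (auto simp: locally_minimal_def)
qed (use locally_minimal_less_length[of w] locally_minimal_less_length[of "map f w"] in auto)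

lemma eis_map:
  assumes "strict_mono_on (set w) f"
  shows "eis (map f w) = map (map (map_option f)) (eis w)"
  unfolding eis_consecutive locally_minimal_map[OF assms] map_map
proof (rule map_cong)
  fix p assume p: "p \<in> set (consecutive (sorted_list_of_set {i. locally_minimal w i} @ [length w]))"
  obtain i j where [simp]: "p = (i, j)" by (cases p)
  have "j \<le> length w"
    using p by (auto dest!: set_consecutive simp: finite_locally_minimal intro: less_imp_le[OF locally_minimal_less_length])
  then show "(case p of (i, j) \<Rightarrow> factor (map f w) i j) =
      (map (map_option f) \<circ> (\<lambda>(i, j). factor w i j)) p"
    by (auto simp: factor_def with_sentinel_nth)
qed simp

lemma set_eis:
  assumes "u \<in> set (eis w)"
  shows "set u \<subseteq> insert None (Some ` set w)"
proof -
  obtain i j where ij: "u = factor w i j"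
    "(i, j) \<in> set (consecutive (sorted_list_of_set {i. locally_minimal w i} @ [length w]))"
    using assms by (auto simp: eis_consecutive)
  then have "j \<le> length w"
    by (auto dest!: set_consecutive simp: finite_locally_minimal intro: less_imp_le[OF locally_minimal_less_length])
  then show ?thesis
    by (auto simp: ij(1) factor_def with_sentinel_nth split: if_splits)
qed

lemma map_option_less:
  fixes f :: "'a::linorder \<Rightarrow> 'b::linorder"
  assumes "strict_mono_on A f" "x \<in> insert None (Some ` A)" "y \<in> insert None (Some ` A)"
  shows "map_option f x < map_option f y \<longleftrightarrow> x < y"
  using assms(2,3) strict_mono_on_less[OF assms(1)] by auto

lemma map_map_option_less:
  fixes f :: "'a::linorder \<Rightarrow> 'b::linorder"
  assumes "strict_mono_on A f" "set u \<subseteq> insert None (Some ` A)" "set v \<subseteq> insert None (Some ` A)"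
  shows "map (map_option f) u < map (map_option f) v \<longleftrightarrow> u < v"
  using assms(2,3)
proof (induction u arbitrary: v)
  case Nil
  then show ?case by (cases v) auto
next
  case (Cons a u)
  show ?case
  proof (cases v)
    case (Cons b v')
    have ab: "map_option f a < map_option f b \<longleftrightarrow> a < b" "map_option f b < map_option f a \<longleftrightarrow> b < a"
      using Cons.prems \<open>v = _\<close> assms(1) by (intro map_option_less; auto)+
    then have "map_option f a = map_option f b \<longleftrightarrow> a = b"
      by (metis less_irrefl neq_iff)
    then show ?thesis
      using Cons.IH[of v'] Cons.prems ab Cons by auto
  qed simp
qed

text \<open>A relabelling that is strictly increasing on the letters preserves the lexicographic
  order of the factors. It is thus injective on them and keeps the number of distinct factors below
  each one.\<close>

lemma is_word_map:
  assumes "strict_mono_on (set w) f"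
  shows "is_word (map f w) = is_word w"
proof -
  let ?g = "map (map_option f)"
  have less: "?g u < ?g v \<longleftrightarrow> u < v" if "u \<in> set (eis w)" "v \<in> set (eis w)" for u v
    using that set_eis by (intro map_map_option_less[OF assms]) auto
  then have inj: "inj_on ?g (set (eis w))"
    by (intro inj_onI) (metis less_irrefl neq_iff)
  have "card {v \<in> ?g ` set (eis w). v < ?g u} = card {v \<in> set (eis w). v < u}"
    if "u \<in> set (eis w)" for u
  proof -
    have "{v \<in> ?g ` set (eis w). v < ?g u} = ?g ` {v \<in> set (eis w). v < u}"
      using less that by auto
    moreover have "inj_on ?g {v \<in> set (eis w). v < u}"
      by (rule inj_on_subset[OF inj]) auto
    ultimately show ?thesis
      by (simp add: card_image)
  qed
  then show ?thesis
    by (simp add: is_word_def eis_map[OF assms])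
qed

section \<open>Lengths of iterates\<close>

lemma length_is_iter_0 [simp]: "length_is_iter 0 w = length w"
  by (simp add: length_is_iter_def)

lemma length_is_iter_Suc_is_word: "length_is_iter (Suc k) w = length_is_iter k (is_word w)"
  by (cases k) (simp_all add: length_is_iter_def funpow_swap1)

lemma length_is_iter_map:
  assumes "strict_mono_on (set w) f"
  shows "length_is_iter k (map f w) = length_is_iter k w"
  by (cases k) (simp_all add: length_is_iter_Suc_is_word is_word_map[OF assms])

lemma strict_mono_on_rank:
  fixes A :: "'a::linorder set"
  assumes "finite A"
  shows "strict_mono_on A (\<lambda>u. card {v \<in> A. v < u})"
proof (rule strict_mono_onI)
  fix r s assume "r \<in> A" "s \<in> A" "r < s"
  then have "{v \<in> A. v < r} \<subset> {v \<in> A. v < s}" by auto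
  then show "card {v \<in> A. v < r} < card {v \<in> A. v < s}"
    using assms by (intro psubset_card_mono) auto
qed

text \<open>Ranking the factors is itself a strictly increasing relabelling, so the remaining
  iterations may start from the word of factors, and the recursion involves no ranks.\<close>

lemma length_is_iter_Suc: "length_is_iter (Suc k) w = length_is_iter k (eis w)"
  unfolding length_is_iter_Suc_is_word is_word_def
  by (rule length_is_iter_map) (simp add: strict_mono_on_rank)

lemma length_is_word_le: "length (is_word w) \<le> length w"
  by (simp add: is_word_def length_eis_le)

lemma length_is_iter_le: "length_is_iter k w \<le> length w"
proof -
  have "length_is_iter k w \<le> length w" for k and w :: "nat list"
    by (induction k arbitrary: w)
      (auto simp: length_is_iter_Suc_is_word intro: order_trans length_is_word_le)
  then show ?thesis
    by (cases k) (simp_all add: length_is_iter_Suc_is_word order_trans[OF _ length_is_word_le[of w]])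
qed

text \<open>A quasimorphism on the free monoid of words, with defect at most
  \<open>c\<close>.\<close>

definition almost_additive :: "real \<Rightarrow> ('a list \<Rightarrow> real) \<Rightarrow> bool" where
  "almost_additive c F \<longleftrightarrow> (\<forall>u v. \<bar>F (u @ v) - F u - F v\<bar> \<le> c)"

text \<open>The rank of letters in \<open>u @ v\<close> is an order isomorphism, so a bound for words over
  \<^typ>\<open>nat\<close> carries over to words over every alphabet.\<close>

lemma almost_additive_length_is_iter_transfer:
  assumes "almost_additive c (\<lambda>w :: nat list. real (length_is_iter k w))"
  shows "almost_additive c (\<lambda>w :: 'a::linorder list. real (length_is_iter k w))"
  unfolding almost_additive_def
proof (intro allI)
  fix u v :: "'a list"
  define f where "f x = card {y \<in> set (u @ v). y < x}" for x
  have mono: "strict_mono_on (set (u @ v)) f"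
    unfolding f_def by (rule strict_mono_on_rank) simp
  then have "strict_mono_on (set u) f" "strict_mono_on (set v) f"
    by (auto simp: monotone_on_def)
  then show "\<bar>real (length_is_iter k (u @ v)) - real (length_is_iter k u) - real (length_is_iter k v)\<bar> \<le> c"
    using assms[unfolded almost_additive_def, rule_format, of "map f u" "map f v"]
      length_is_iter_map[OF mono, of k]
    by (simp add: length_is_iter_map)
qed

text \<open>The words \<open>eis u\<close> and \<open>eis (u @ v)\<close> share the prefix
  \<open>E\<close>, and the latter ends with \<open>eis v\<close>. Three splittings cost
  \<open>c\<close> each; the border pieces contribute at most 1 and 3.\<close>

lemma almost_additive_length_is_iter_Suc:
  assumes "almost_additive c (\<lambda>w :: 'a::linorder option list list. real (length_is_iter k w))"
  shows "almost_additive (3 * c + 4) (\<lambda>w :: 'a list. real (length_is_iter (Suc k) w))"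
  unfolding almost_additive_def
proof (intro allI)
  fix u v :: "'a list"
  define L :: "'a option list list \<Rightarrow> real" where "L w = real (length_is_iter k w)" for w
  have L: "\<bar>L (a @ b) - L a - L b\<bar> \<le> c" for a b
    using assms by (simp add: almost_additive_def L_def)
  have le: "0 \<le> L a" "L a \<le> length a" for a
    by (simp_all add: L_def length_is_iter_le)
  obtain E x y where E: "eis u = E @ x" "eis (u @ v) = E @ y @ eis v" "length x \<le> 1" "length y \<le> 3"
    by (rule eis_append)
  have "\<bar>L (E @ y @ eis v) - L (E @ x) - L (eis v)\<bar> \<le> 3 * c + 4"
    using L[of E "y @ eis v"] L[of y "eis v"] L[of E x] le[of x] le[of y] E(3,4) by linarith
  then show "\<bar>real (length_is_iter (Suc k) (u @ v)) - real (length_is_iter (Suc k) u)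
      - real (length_is_iter (Suc k) v)\<bar> \<le> 3 * c + 4"
    by (simp add: length_is_iter_Suc E L_def)
qed

text \<open>The type of letters changes at each level, so the induction is carried out for the
  single type \<open>nat\<close>. Transfer restores the hypothesis for words of factors over
  \<open>nat\<close>, and at the end reaches every other alphabet.\<close>

lemma almost_additive_length_is_iter:
  obtains c where "almost_additive c (\<lambda>w :: 'a::linorder list. real (length_is_iter k w))"
proof -
  have "\<exists>c. almost_additive c (\<lambda>w :: nat list. real (length_is_iter k w))"
  proof (induction k)
    case 0
    show ?case by (intro exI[of _ 0]) (simp add: almost_additive_def)
  next
    case (Suc k)
    then obtain c where "almost_additive c (\<lambda>w :: nat list. real (length_is_iter k w))" ..
    then have "almost_additive c (\<lambda>w :: nat option list list. real (length_is_iter k w))"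
      by (rule almost_additive_length_is_iter_transfer)
    then show ?case
      by (blast intro: almost_additive_length_is_iter_Suc)
  qed
  then show thesis
    using that almost_additive_length_is_iter_transfer by blast
qed

lemma almost_additive_rev:
  assumes "almost_additive c F"
  shows "almost_additive c (\<lambda>w. F (rev w))"
  unfolding almost_additive_def
proof (intro allI)
  fix u v
  show "\<bar>F (rev (u @ v)) - F (rev u) - F (rev v)\<bar> \<le> c"
    using assms[unfolded almost_additive_def, rule_format, of "rev v" "rev u"] by simp
qed

section \<open>Bounded functions on discrete distributions\<close>

lemma integrable_pmf_bounded:
  fixes f :: "'a \<Rightarrow> real"
  assumes "\<And>x. x \<in> set_pmf p \<Longrightarrow> \<bar>f x\<bar> \<le> B"
  shows "integrable (measure_pmf p) f"
  using assms by (intro measure_pmf.integrable_const_bound[where B = B]) (auto simp: AE_measure_pmf_iff)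

lemma integral_bind_pmf_bounded:
  fixes f :: "'a \<Rightarrow> real"
  assumes "\<And>x. \<bar>f x\<bar> \<le> B"
  shows "(\<integral>x. f x \<partial>bind_pmf p q) = (\<integral>y. (\<integral>x. f x \<partial>q y) \<partial>p)"
  unfolding measure_pmf_bind
  by (rule integral_bind[where K = "count_space UNIV" and B = B and B' = 1])
    (auto simp: assms measure_pmf_in_subprob_algebra)

lemma integral_pmf_mono:
  fixes f g :: "'a \<Rightarrow> real"
  assumes "integrable (measure_pmf p) f" "integrable (measure_pmf p) g"
    and "\<And>x. x \<in> set_pmf p \<Longrightarrow> f x \<le> g x"
  shows "(\<integral>x. f x \<partial>measure_pmf p) \<le> (\<integral>x. g x \<partial>measure_pmf p)"
  using assms by (intro integral_mono_AE) (auto simp: AE_measure_pmf_iff)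

lemma integral_pmf_diff_le:
  fixes f g :: "'a \<Rightarrow> real"
  assumes f: "integrable (measure_pmf p) f" and g: "integrable (measure_pmf p) g"
    and le: "\<And>x. x \<in> set_pmf p \<Longrightarrow> \<bar>f x - g x\<bar> \<le> e"
  shows "\<bar>(\<integral>x. f x \<partial>measure_pmf p) - (\<integral>x. g x \<partial>measure_pmf p)\<bar> \<le> e"
proof -
  have "(\<integral>x. f x \<partial>measure_pmf p) \<le> (\<integral>x. g x + e \<partial>measure_pmf p)"
    using f g le by (intro integral_pmf_mono) (auto simp: abs_le_iff algebra_simps)
  moreover have "(\<integral>x. g x \<partial>measure_pmf p) \<le> (\<integral>x. f x + e \<partial>measure_pmf p)"
    using f g by (intro integral_pmf_mono) (auto dest!: le simp: abs_le_iff algebra_simps)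
  ultimately show ?thesis
    using f g by (simp add: abs_le_iff)
qed

lemma integral_pmf_dominated_convergence:
  fixes f :: "nat \<Rightarrow> 'a \<Rightarrow> real"
  assumes "\<And>x. x \<in> set_pmf p \<Longrightarrow> (\<lambda>n. f n x) \<longlonglongrightarrow> g x"
    and "\<And>n x. x \<in> set_pmf p \<Longrightarrow> \<bar>f n x\<bar> \<le> B"
  shows "(\<lambda>n. \<integral>x. f n x \<partial>measure_pmf p) \<longlonglongrightarrow> (\<integral>x. g x \<partial>measure_pmf p)"
  using assms by (intro integral_dominated_convergence[where w = "\<lambda>_. B"]) (auto simp: AE_measure_pmf_iff)

lemma pmf_times_le_integral:
  fixes f :: "'a \<Rightarrow> real"
  assumes "\<And>x. 0 \<le> f x" "\<And>x. f x \<le> B"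
  shows "pmf p y * f y \<le> (\<integral>x. f x \<partial>measure_pmf p)"
proof -
  have "(\<integral>x. indicator {y} x * f y \<partial>measure_pmf p) \<le> (\<integral>x. f x \<partial>measure_pmf p)"
    using assms order_trans[OF assms(1) assms(2)]
    by (intro integral_pmf_mono integrable_pmf_bounded[where B = B]) (auto split: split_indicator)
  then show ?thesis
    by (simp add: measure_pmf_single)
qed

section \<open>Real sequences\<close>

text \<open>A two-sided form of Fekete's lemma: \<open>b (m * n)\<close> is close both to
  \<open>m * b n\<close> and to \<open>n * b m\<close>, which makes the quotients a Cauchy
  sequence.\<close>

lemma almost_additive_sequence_converges:
  fixes b :: "nat \<Rightarrow> real"
  assumes "\<And>m n. \<bar>b (m + n) - b m - b n\<bar> \<le> c"
  shows "convergent (\<lambda>n. b n / n)"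
proof -
  have c: "0 \<le> c" using assms[of 0 0] by linarith
  have mult: "\<bar>b (k * n) - k * b n\<bar> \<le> (k + 1) * c" for k n
  proof (induction k)
    case 0
    show ?case using assms[of 0 0] by simp
  next
    case (Suc k)
    have "\<bar>b (Suc k * n) - Suc k * b n\<bar> \<le> \<bar>b (n + k * n) - b n - b (k * n)\<bar> + \<bar>b (k * n) - k * b n\<bar>"
      by (simp add: algebra_simps)
    also have "\<dots> \<le> c + (k + 1) * c"
      using assms Suc.IH by (intro add_mono) (auto simp: add.commute)
    finally show ?case by (simp add: algebra_simps)
  qed
  have bound: "\<bar>b n / n - b m / m\<bar> \<le> 2 * c / n + 2 * c / m" if "n \<ge> 1" "m \<ge> 1" for m n :: nat
  proof -
    have "\<bar>m * b n - n * b m\<bar> \<le> (m + 1) * c + (n + 1) * c"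
      using mult[of m n] mult[of n m] unfolding mult.commute[of n m] abs_le_iff by (simp add: algebra_simps)
    also have "\<dots> \<le> 2 * m * c + 2 * n * c"
      using that c by (intro add_mono mult_right_mono) auto
    finally have *: "\<bar>m * b n - n * b m\<bar> \<le> 2 * m * c + 2 * n * c" .
    have "\<bar>b n / n - b m / m\<bar> = \<bar>m * b n - n * b m\<bar> / (m * n)"
      using that by (simp add: field_simps)
    also have "\<dots> \<le> (2 * m * c + 2 * n * c) / (m * n)"
      using * that by (intro divide_right_mono) auto
    also have "\<dots> = 2 * c / n + 2 * c / m"
      using that by (simp add: field_simps)
    finally show ?thesis .
  qed
  have "Cauchy (\<lambda>n. b n / n)"
  proof (rule metric_CauchyI)
    fix e :: real assume "e > 0"
    obtain N :: nat where N: "4 * c / e < N" using reals_Archimedean2 by blast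
    have small: "2 * c / n < e / 2" if "n \<ge> Suc N" for n
    proof -
      have "4 * c / e < n" using N that by linarith
      then show ?thesis using \<open>e > 0\<close> that by (simp add: field_simps)
    qed
    have "dist (b m / m) (b n / n) < e" if "m \<ge> Suc N" "n \<ge> Suc N" for m n
      using bound[of m n] small[of m] small[of n] that by (simp add: dist_real_def)
    then show "\<exists>N. \<forall>m\<ge>N. \<forall>n\<ge>N. dist (b m / m) (b n / n) < e" by blast
  qed
  then show ?thesis by (simp add: Cauchy_convergent_iff)
qed

lemma sq_diff_le:
  fixes x y :: real
  assumes "\<bar>x\<bar> \<le> 1" "\<bar>y\<bar> \<le> 1"
  shows "\<bar>x\<^sup>2 - y\<^sup>2\<bar> \<le> 2 * \<bar>x - y\<bar>"
proof -
  have "\<bar>x\<^sup>2 - y\<^sup>2\<bar> = \<bar>x + y\<bar> * \<bar>x - y\<bar>"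
    by (simp add: power2_eq_square flip: abs_mult) (simp add: algebra_simps)
  also have "\<dots> \<le> 2 * \<bar>x - y\<bar>"
    using assms by (intro mult_right_mono) auto
  finally show ?thesis .
qed

lemma tendsto_const_over_add: "(\<lambda>n. C / real (n + t)) \<longlonglongrightarrow> 0"
  by (rule LIMSEQ_ignore_initial_segment[OF lim_const_over_n])

lemma halving_recursion_tendsto_0:
  fixes V d :: "nat \<Rightarrow> real"
  assumes V: "\<And>n. 0 \<le> V n" "\<And>n. V n \<le> B" and d: "d \<longlonglongrightarrow> 0"
    and rec: "\<And>n. V n \<le> V (n div 2) / 2 + d n"
  shows "V \<longlonglongrightarrow> 0"
proof (rule LIMSEQ_I)
  fix r :: real assume "r > 0"
  define e where "e = r / 4"
  have "e > 0" using \<open>r > 0\<close> by (simp add: e_def)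
  then obtain N where N: "\<And>n. n \<ge> N \<Longrightarrow> d n < e"
    using order_tendstoD(2)[OF d] by (auto simp: eventually_sequentially)
  \<comment> \<open>The number \<open>2 * e\<close> is the fixed point of \<open>t / 2 + e\<close>,
    so one more use of the recursion halves the first term and keeps the second. The choice
    \<open>e = r / 4\<close> leaves room for \<open>B / 2 ^ k < 2 * e\<close>.\<close>
  have "\<exists>K. \<forall>n\<ge>K. V n \<le> B / 2 ^ k + 2 * e" for k
  proof (induction k)
    case 0
    show ?case using V(2) \<open>e > 0\<close> by (auto intro!: exI[of _ 0] add_increasing2)
  next
    case (Suc k)
    then obtain K where K: "\<And>n. n \<ge> K \<Longrightarrow> V n \<le> B / 2 ^ k + 2 * e" by blast
    have "V n \<le> B / 2 ^ Suc k + 2 * e" if "n \<ge> max N (2 * K)" for n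
    proof -
      have "V (n div 2) \<le> B / 2 ^ k + 2 * e" using that by (intro K) auto
      then show ?thesis using rec[of n] N[of n] that by simp
    qed
    then show ?case by blast
  qed
  moreover have "(\<lambda>k. B / 2 ^ k) \<longlonglongrightarrow> 0"
    using tendsto_mult[OF tendsto_const[of B] LIMSEQ_realpow_zero[of "1 / 2"]] by (simp add: power_one_over)
  then obtain k where "B / 2 ^ k < 2 * e"
    using order_tendstoD(2)[of _ 0 sequentially "2 * e"] \<open>e > 0\<close> by (auto simp: eventually_sequentially)
  ultimately obtain K where K: "\<And>n. n \<ge> K \<Longrightarrow> V n \<le> B / 2 ^ k + 2 * e" by blast
  have "norm (V n - 0) < r" if "n \<ge> K" for n
    using K[OF that] V(1)[of n] \<open>B / 2 ^ k < 2 * e\<close> unfolding e_def real_norm_def by linarith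
  then show "\<exists>K. \<forall>n\<ge>K. norm (V n - 0) < r" by blast
qed

section \<open>Laws of finite pieces of a Markov chain\<close>

text \<open>The joint law of the word \<open>X\<^sub>0 \<dots> X\<^sub>n\<^sub>-\<^sub>1\<close> and of the next state \<open>X\<^sub>n\<close>.\<close>

primrec path_law :: "('a \<Rightarrow> 'a pmf) \<Rightarrow> 'a pmf \<Rightarrow> nat \<Rightarrow> ('a list \<times> 'a) pmf" where
  "path_law M \<mu> 0 = map_pmf (Pair []) \<mu>"
| "path_law M \<mu> (Suc n) = bind_pmf (path_law M \<mu> n) (\<lambda>(l, z). map_pmf (Pair (l @ [z])) (M z))"

definition word_law :: "('a \<Rightarrow> 'a pmf) \<Rightarrow> 'a pmf \<Rightarrow> nat \<Rightarrow> 'a list pmf" where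
  "word_law M \<mu> n = map_pmf fst (path_law M \<mu> n)"

definition state_law :: "('a \<Rightarrow> 'a pmf) \<Rightarrow> 'a pmf \<Rightarrow> nat \<Rightarrow> 'a pmf" where
  "state_law M \<mu> n = map_pmf snd (path_law M \<mu> n)"

lemma path_bind: "path_law M \<mu> n = bind_pmf \<mu> (\<lambda>x. path_law M (return_pmf x) n)"
proof (induction n)
  case 0
  show ?case by (simp add: map_pmf_def bind_return_pmf)
next
  case (Suc n)
  have "path_law M \<mu> (Suc n) =
      bind_pmf (bind_pmf \<mu> (\<lambda>x. path_law M (return_pmf x) n)) (\<lambda>(l, z). map_pmf (Pair (l @ [z])) (M z))"
    by (simp add: Suc.IH[symmetric])
  then show ?case by (simp add: bind_assoc_pmf)
qed

lemma word_bind: "word_law M \<mu> n = bind_pmf \<mu> (\<lambda>x. word_law M (return_pmf x) n)"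
  unfolding word_law_def by (subst path_bind) (simp add: map_bind_pmf)

text \<open>The Markov property at time \<open>m\<close>: given the past, the rest is a path started
  afresh from the state \<open>z\<close> that has been reached.\<close>

lemma path_add:
  "path_law M \<mu> (m + n) = bind_pmf (path_law M \<mu> m)
     (\<lambda>(l, z). map_pmf (\<lambda>(l', z'). (l @ l', z')) (path_law M (return_pmf z) n))"
proof (induction n)
  case 0
  show ?case by (simp add: split_def bind_return_pmf')
next
  case (Suc n)
  show ?case
    by (simp add: Suc.IH bind_assoc_pmf split_def map_bind_pmf bind_map_pmf map_pmf_comp)
qed

lemma length_path: "(l, z) \<in> set_pmf (path_law M \<mu> n) \<Longrightarrow> length l = n"
  by (induction n arbitrary: l z) (auto simp: split_def)

lemma length_word: "w \<in> set_pmf (word_law M \<mu> n) \<Longrightarrow> length w = n"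
  by (auto simp: word_law_def length_path)

lemma state_Suc: "state_law M \<mu> (Suc n) = bind_pmf (state_law M \<mu> n) M"
  by (simp add: state_law_def map_bind_pmf bind_map_pmf split_def map_pmf_comp)

lemma state_0: "state_law M \<mu> 0 = \<mu>"
  by (simp add: state_law_def map_pmf_comp)

lemma state_stationary: "bind_pmf \<nu> M = \<nu> \<Longrightarrow> state_law M \<nu> n = \<nu>"
  by (induction n) (simp_all add: state_0 state_Suc)

text \<open>A coupling of two adjacent blocks: both marginals and the law of the concatenation are
  laws of words of the chain, so differences of expectations reduce to pointwise estimates for
  \<open>u\<close>, \<open>v\<close> and \<open>u @ v\<close>.\<close>

definition two_words :: "('a \<Rightarrow> 'a pmf) \<Rightarrow> 'a pmf \<Rightarrow> nat \<Rightarrow> nat \<Rightarrow> ('a list \<times> 'a list) pmf" where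
  "two_words M \<mu> m n = bind_pmf (path_law M \<mu> m) (\<lambda>(l, z). map_pmf (Pair l) (word_law M (return_pmf z) n))"

lemma map_fst_two_words: "map_pmf fst (two_words M \<mu> m n) = word_law M \<mu> m"
  by (simp add: two_words_def word_law_def map_bind_pmf split_def map_pmf_comp)
    (simp add: map_pmf_def)

lemma map_snd_two_words: "map_pmf snd (two_words M \<mu> m n) = word_law M (state_law M \<mu> m) n"
  by (subst word_bind) (simp add: two_words_def state_law_def map_bind_pmf split_def map_pmf_comp bind_map_pmf)

lemma map_append_two_words: "map_pmf (\<lambda>(u, v). u @ v) (two_words M \<mu> m n) = word_law M \<mu> (m + n)"
  by (simp add: two_words_def word_law_def path_add map_bind_pmf split_def map_pmf_comp)

lemma set_two_words:
  assumes "p \<in> set_pmf (two_words M \<mu> m n)"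
  shows "length (fst p) = m" "length (snd p) = n"
proof -
  have "fst p \<in> set_pmf (word_law M \<mu> m)" "snd p \<in> set_pmf (word_law M (state_law M \<mu> m) n)"
    unfolding map_fst_two_words[of M \<mu> m n, symmetric] map_snd_two_words[symmetric]
    using assms by simp_all
  then show "length (fst p) = m" "length (snd p) = n"
    by (simp_all add: length_word)
qed

section \<open>Almost additive functionals of a stationary chain\<close>

text \<open>Tychonoff's theorem; countability of the index type makes the product metrizable, so
  that compactness yields convergent subsequences.\<close>

lemma seq_compact_unit_functions:
  fixes f :: "nat \<Rightarrow> 'a::countable \<Rightarrow> real"
  assumes "\<And>n x. f n x \<in> {0..1}"
  obtains r g where "strict_mono r" "\<And>x. (\<lambda>n. f (r n) x) \<longlonglongrightarrow> g x"
proof -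
  have "compactin (product_topology (\<lambda>_. euclidean) UNIV) (PiE UNIV (\<lambda>_::'a. {0..1::real}))"
    by (subst compactin_PiE) auto
  then have "compact (PiE UNIV (\<lambda>_::'a. {0..1::real}))"
    by (simp add: euclidean_product_topology)
  moreover have "\<forall>n. f n \<in> PiE UNIV (\<lambda>_. {0..1})"
    using assms by auto
  ultimately obtain g r where "strict_mono r" "(f \<circ> r) \<longlonglongrightarrow> g"
    unfolding compact_def by blast
  moreover have "(\<lambda>n. f (r n) x) \<longlonglongrightarrow> g x" for x
    using continuous_on_tendsto_compose[OF continuous_on_product_coordinates \<open>(f \<circ> r) \<longlonglongrightarrow> g\<close>]
    by (simp add: o_def)
  ultimately show thesis using that by blast
qed

text \<open>Stationarity makes the Dirichlet form of a harmonic function vanish.\<close>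

lemma harmonic_edge:
  fixes f :: "'a \<Rightarrow> real"
  assumes \<nu>: "bind_pmf \<nu> M = \<nu>" and f: "\<And>x. f x \<in> {0..1}"
    and harmonic: "\<And>x. (\<integral>y. f y \<partial>M x) = f x"
    and x: "x \<in> set_pmf \<nu>" and y: "y \<in> set_pmf (M x)"
  shows "f y = f x"
proof -
  have bd: "\<bar>f x\<bar> \<le> 1" "\<bar>(f x)\<^sup>2\<bar> \<le> 1" "\<bar>f x * f y\<bar> \<le> 1" for x y
    using f[of x] f[of y] by (auto simp: abs_mult power_le_one mult_le_one)
  have int: "integrable (measure_pmf p) f" "integrable (measure_pmf p) (\<lambda>y. (f y)\<^sup>2)" for p
    by (rule integrable_pmf_bounded, rule bd)+
  \<comment> \<open>By harmonicity \<open>f x\<close> is the mean of \<open>f\<close> under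
    \<open>M x\<close>, so this is the usual formula for a variance.\<close>
  have sq: "(\<integral>y. (f y - f x)\<^sup>2 \<partial>M x) = (\<integral>y. (f y)\<^sup>2 \<partial>M x) - (f x)\<^sup>2" for x
  proof -
    have "(\<integral>y. (f y - f x)\<^sup>2 \<partial>M x) = (\<integral>y. (f y)\<^sup>2 - 2 * f x * f y + (f x)\<^sup>2 \<partial>M x)"
      by (intro Bochner_Integration.integral_cong) (auto simp: power2_eq_square algebra_simps)
    also have "\<dots> = (\<integral>y. (f y)\<^sup>2 \<partial>M x) - 2 * f x * f x + (f x)\<^sup>2"
      using int[of "M x"] by (simp add: harmonic)
    finally show ?thesis by (simp add: power2_eq_square)
  qed
  have le1: "\<bar>(\<integral>y. (f y)\<^sup>2 \<partial>M x)\<bar> \<le> 1" for x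
    using integral_pmf_diff_le[OF int(2), of "M x" "\<lambda>_. 0" 1] bd by simp
  have sq_bd: "\<bar>(f y - f x)\<^sup>2\<bar> \<le> 1" for x y
    using f[of x] f[of y] by (auto simp: abs_square_le_1)
  have int_sq: "integrable (measure_pmf p) (\<lambda>y. (f y - f x)\<^sup>2)" for p x
    by (rule integrable_pmf_bounded, rule sq_bd)
  have le1': "\<bar>(\<integral>y. (f y - f x)\<^sup>2 \<partial>M x)\<bar> \<le> 1" for x
    using integral_pmf_diff_le[OF int_sq, of "M x" "\<lambda>_. 0" x 1] sq_bd by simp
  have "(\<integral>x. (\<integral>y. (f y - f x)\<^sup>2 \<partial>M x) \<partial>\<nu>) = (\<integral>x. (\<integral>y. (f y)\<^sup>2 \<partial>M x) \<partial>\<nu>) - (\<integral>x. (f x)\<^sup>2 \<partial>\<nu>)"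
    unfolding sq by (intro Bochner_Integration.integral_diff int integrable_pmf_bounded[OF le1])
  \<comment> \<open>One step of the chain preserves \<nu>, hence the mean of the square of
    \<open>f\<close>. The average variance is therefore zero, and \<open>f\<close> does not change
    along edges that start in the support.\<close>
  also have "(\<integral>x. (\<integral>y. (f y)\<^sup>2 \<partial>M x) \<partial>\<nu>) = (\<integral>x. (f x)\<^sup>2 \<partial>\<nu>)"
    using integral_bind_pmf_bounded[of "\<lambda>x. (f x)\<^sup>2" 1 \<nu> M] bd by (simp add: \<nu>)
  finally have "(\<integral>x. (\<integral>y. (f y - f x)\<^sup>2 \<partial>M x) \<partial>\<nu>) = 0" by simp
  then have "AE x in \<nu>. (\<integral>y. (f y - f x)\<^sup>2 \<partial>M x) = 0"
    by (subst (asm) integral_nonneg_eq_0_iff_AE) (auto intro: integrable_pmf_bounded le1')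
  then have "(\<integral>y. (f y - f x)\<^sup>2 \<partial>M x) = 0"
    using x by (simp add: AE_measure_pmf_iff)
  then have "AE y in M x. (f y - f x)\<^sup>2 = 0"
    using int_sq by (subst (asm) integral_nonneg_eq_0_iff_AE) auto
  then show ?thesis
    using y by (simp add: AE_measure_pmf_iff)
qed

section \<open>Densities of almost additive functionals\<close>

locale almost_additive_functional =
  fixes F :: "'a list \<Rightarrow> real" and c :: real
  assumes nonneg: "0 \<le> F w" and le_length: "F w \<le> length w" and almost_additive: "almost_additive c F"
begin

text \<open>The empty word gets density 0, by division by zero; \<open>F_eq\<close> still holds for
  it, since \<open>nonneg\<close> and \<open>le_length\<close> force \<open>F []\<close> to
  vanish.\<close>

definition G :: "'a list \<Rightarrow> real" where "G w = F w / length w"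

lemma G_bounds: "0 \<le> G w" "G w \<le> 1"
  using nonneg[of w] le_length[of w] by (auto simp: G_def divide_le_eq_1)

lemma F_eq: "F w = length w * G w"
  using nonneg[of w] le_length[of w] by (auto simp: G_def)

lemma c_nonneg: "0 \<le> c"
  using almost_additive[unfolded almost_additive_def, rule_format, of "[]" "[]"] by linarith

lemma G_append_sum:
  "\<bar>(length u + length v) * G (u @ v) - length u * G u - length v * G v\<bar> \<le> c"
  using almost_additive[unfolded almost_additive_def, rule_format, of u v] by (simp add: F_eq)

text \<open>Multiplied by the total length, the difference is the defect of additivity plus
  \<open>length v * (G v - G u)\<close>, and densities lie in the unit interval. If both words are
  empty, both sides are 0.\<close>

lemma G_append_left: "\<bar>G (u @ v) - G u\<bar> \<le> (c + length v) / (length u + length v)"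
proof (cases "length u + length v = 0")
  case False
  then have pos: "0 < real (length u + length v)" by linarith
  have "0 \<le> length v * G v" "length v * G v \<le> length v" "0 \<le> length v * G u" "length v * G u \<le> length v"
    using G_bounds by (auto intro: mult_left_le)
  then have "\<bar>(length u + length v) * (G (u @ v) - G u)\<bar> \<le> c + length v"
    using G_append_sum[of u v] by (simp add: algebra_simps)
  then show ?thesis
    using pos by (simp add: abs_mult pos_le_divide_eq mult.commute)
qed (simp)

lemma G_append_right: "\<bar>G (u @ v) - G v\<bar> \<le> (c + length u) / (length u + length v)"
proof (cases "length u + length v = 0")
  case False
  then have pos: "0 < real (length u + length v)" by linarith
  have "0 \<le> length u * G v" "length u * G v \<le> length u" "0 \<le> length u * G u" "length u * G u \<le> length u"
    using G_bounds by (auto intro: mult_left_le)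
  then have "\<bar>(length u + length v) * (G (u @ v) - G v)\<bar> \<le> c + length u"
    using G_append_sum[of u v] by (simp add: algebra_simps)
  then show ?thesis
    using pos by (simp add: abs_mult pos_le_divide_eq mult.commute)
qed (simp)

lemma integrable_G: "integrable (measure_pmf p) (\<lambda>x. G (h x))"
  using G_bounds by (intro integrable_pmf_bounded[where B = 1]) auto

end

text \<open>The terminal component appears as the support of \<nu>; irreducibility is asked for only
  there, and states outside it are unrestricted.\<close>

locale stationary_chain_functional = almost_additive_functional F c
  for F :: "'a::countable list \<Rightarrow> real" and c +
  fixes M :: "'a \<Rightarrow> 'a pmf" and \<nu> :: "'a pmf"
  assumes stationary: "bind_pmf \<nu> M = \<nu>"
    and irreducible: "x \<in> set_pmf \<nu> \<Longrightarrow> y \<in> set_pmf \<nu> \<Longrightarrow> (x, y) \<in> (edges M)\<^sup>*"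
begin

section \<open>Limit of the expected densities\<close>

definition \<Phi> :: "'a pmf \<Rightarrow> nat \<Rightarrow> real" where
  "\<Phi> \<mu> n = (\<integral>w. G w \<partial>word_law M \<mu> n)"

definition \<phi> :: "nat \<Rightarrow> 'a \<Rightarrow> real" where
  "\<phi> n x = \<Phi> (return_pmf x) n"

lemma \<Phi>_bounds: "0 \<le> \<Phi> \<mu> n" "\<Phi> \<mu> n \<le> 1"
proof -
  show "0 \<le> \<Phi> \<mu> n" unfolding \<Phi>_def using G_bounds by (intro Bochner_Integration.integral_nonneg) auto
  have "\<Phi> \<mu> n \<le> (\<integral>w. 1 \<partial>word_law M \<mu> n)"
    unfolding \<Phi>_def using G_bounds integrable_G[of _ "\<lambda>x. x"] by (intro integral_pmf_mono) auto
  then show "\<Phi> \<mu> n \<le> 1" by simp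
qed

lemma \<phi>_bounds: "\<phi> n x \<in> {0..1}"
  using \<Phi>_bounds by (simp add: \<phi>_def)

lemma \<Phi>_eq: "\<Phi> \<mu> n = (\<integral>x. \<phi> n x \<partial>\<mu>)"
  unfolding \<Phi>_def \<phi>_def using G_bounds
  by (subst word_bind) (intro integral_bind_pmf_bounded[where B = 1], auto)

text \<open>In the coupling, dropping the first block leaves a word started from the law of the
  chain at time \<open>m\<close>.\<close>

lemma \<Phi>_add_state: "\<bar>\<Phi> \<mu> (m + n) - \<Phi> (state_law M \<mu> m) n\<bar> \<le> (c + m) / (m + n)"
  unfolding \<Phi>_def map_snd_two_words[symmetric] map_append_two_words[symmetric] integral_map_pmf
  by (intro integral_pmf_diff_le integrable_G) (metis G_append_right set_two_words case_prod_unfold)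

lemma \<Phi>_add_left: "\<bar>\<Phi> \<mu> (m + n) - \<Phi> \<mu> m\<bar> \<le> (c + n) / (m + n)"
  unfolding \<Phi>_def map_fst_two_words[of M \<mu> m n, symmetric] map_append_two_words[symmetric] integral_map_pmf
  by (intro integral_pmf_diff_le integrable_G) (metis G_append_left set_two_words case_prod_unfold)

text \<open>A word of length \<open>n + 1\<close> from \<open>x\<close> becomes, without its first
  letter, a word of length \<open>n\<close> started from \<open>M x\<close>, and without its last
  letter one started from \<open>x\<close>. Each deletion costs at most
  \<open>(c + 1) / (n + 1)\<close>.\<close>

lemma \<phi>_almost_harmonic: "\<bar>(\<integral>y. \<phi> n y \<partial>M x) - \<phi> n x\<bar> \<le> 2 * ((c + 1) / Suc n)"
proof -
  have "state_law M (return_pmf x) 1 = M x"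
    using state_Suc[of M "return_pmf x" 0] by (simp add: state_0 bind_return_pmf)
  then show ?thesis
    using \<Phi>_add_state[of "return_pmf x" 1 n] \<Phi>_add_left[of "return_pmf x" n 1]
    unfolding \<Phi>_eq[of "M x", symmetric] \<phi>_def[of n x] \<open>state_law M (return_pmf x) 1 = M x\<close>
    by (simp only: abs_le_iff add.commute[of 1 n] Suc_eq_plus1 of_nat_1 add.commute[of 1 c]) linarith
qed

text \<open>Under \<nu> the second block has the law of a first block of its length, so the
  pointwise estimate for densities can be integrated.\<close>

lemma \<Phi>_stationary_almost_additive:
  "\<bar>real (m + n) * \<Phi> \<nu> (m + n) - real m * \<Phi> \<nu> m - real n * \<Phi> \<nu> n\<bar> \<le> c"
proof -
  let ?J = "two_words M \<nu> m n"
  have "real m * \<Phi> \<nu> m = (\<integral>p. real m * G (fst p) \<partial>measure_pmf ?J)"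
    by (simp add: \<Phi>_def map_fst_two_words[of M \<nu> m n, symmetric])
  moreover have "real n * \<Phi> \<nu> n = (\<integral>p. real n * G (snd p) \<partial>measure_pmf ?J)"
    using map_snd_two_words[of M \<nu> m n, symmetric]
    by (simp add: \<Phi>_def state_stationary[OF stationary])
  moreover have "real (m + n) * \<Phi> \<nu> (m + n) = (\<integral>p. real (m + n) * G (fst p @ snd p) \<partial>measure_pmf ?J)"
    by (simp add: \<Phi>_def map_append_two_words[symmetric] split_def)
  moreover have "\<bar>(\<integral>p. real (m + n) * G (fst p @ snd p) \<partial>measure_pmf ?J) - (\<integral>p. real m * G (fst p) + real n * G (snd p) \<partial>measure_pmf ?J)\<bar> \<le> c"
  proof (rule integral_pmf_diff_le)
    fix p assume "p \<in> set_pmf ?J"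
    then have "length (fst p) = m" "length (snd p) = n" by (rule set_two_words)+
    then show "\<bar>real (m + n) * G (fst p @ snd p) - (real m * G (fst p) + real n * G (snd p))\<bar> \<le> c"
      using G_append_sum[of "fst p" "snd p"] by (simp add: algebra_simps)
  qed (intro Bochner_Integration.integrable_add integrable_mult_right integrable_G)+
  ultimately show ?thesis
    by (simp only: Bochner_Integration.integral_add integrable_mult_right integrable_G diff_diff_eq)
qed

definition \<gamma> :: real where "\<gamma> = lim (\<Phi> \<nu>)"

lemma tendsto_\<gamma>: "\<Phi> \<nu> \<longlonglongrightarrow> \<gamma>"
proof -
  have "convergent (\<lambda>n. n * \<Phi> \<nu> n / n)"
    using \<Phi>_stationary_almost_additive
    by (intro almost_additive_sequence_converges[where c = c]) simp
  then obtain L where "(\<lambda>n. n * \<Phi> \<nu> n / n) \<longlonglongrightarrow> L" by (auto simp: convergent_def)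
  moreover have "\<forall>\<^sub>F n in sequentially. n * \<Phi> \<nu> n / n = \<Phi> \<nu> n"
    using eventually_gt_at_top[of "0::nat"] by eventually_elim simp
  ultimately have "\<Phi> \<nu> \<longlonglongrightarrow> L" by (blast intro: Lim_transform_eventually)
  then show ?thesis by (simp add: \<gamma>_def limI)
qed

lemma \<gamma>_bounds: "0 \<le> \<gamma>" "\<gamma> \<le> 1"
  using LIMSEQ_le_const[OF tendsto_\<gamma>] LIMSEQ_le_const2[OF tendsto_\<gamma>] \<Phi>_bounds by blast+

text \<open>The limit is harmonic by dominated convergence, so it is constant on the support. The
  constant is its mean under \<nu>, which is the limit of the stationary means along
  \<open>r\<close>.\<close>

lemma subsequential_limit:
  assumes r: "strict_mono r" and f: "\<And>x. (\<lambda>n. \<phi> (r n) x) \<longlonglongrightarrow> f x" and x: "x \<in> set_pmf \<nu>"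
  shows "f x = \<gamma>"
proof -
  have f_bounds: "f x \<in> {0..1}" for x
    using LIMSEQ_le_const[OF f[of x], of 0] LIMSEQ_le_const2[OF f[of x], of 1] \<phi>_bounds by auto
  have harmonic: "(\<integral>y. f y \<partial>M x) = f x" for x
  proof -
    have "(\<lambda>n. (\<integral>y. \<phi> (r n) y \<partial>M x) - \<phi> (r n) x) \<longlonglongrightarrow> (\<integral>y. f y \<partial>M x) - f x"
      using f \<phi>_bounds by (intro tendsto_diff integral_pmf_dominated_convergence[where B = 1]) auto
    moreover have "(\<lambda>n. (\<integral>y. \<phi> (r n) y \<partial>M x) - \<phi> (r n) x) \<longlonglongrightarrow> 0"
    proof (rule Lim_null_comparison)
      show "\<forall>\<^sub>F n in sequentially. norm ((\<integral>y. \<phi> (r n) y \<partial>M x) - \<phi> (r n) x) \<le> 2 * ((c + 1) / Suc (r n))"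
        using \<phi>_almost_harmonic by simp
      have "(\<lambda>n. 2 * ((c + 1) / Suc n)) \<longlonglongrightarrow> 2 * 0"
        by (intro tendsto_mult tendsto_const LIMSEQ_Suc[OF lim_const_over_n])
      then show "(\<lambda>n. 2 * ((c + 1) / Suc (r n))) \<longlonglongrightarrow> 0"
        using LIMSEQ_subseq_LIMSEQ[OF _ r] by (force simp: o_def)
    qed
    ultimately show ?thesis using LIMSEQ_unique by fastforce
  qed
  have const: "f y = f x" if "y \<in> set_pmf \<nu>" for y
  proof -
    have "(x, y) \<in> (edges M)\<^sup>*" using irreducible x that by blast
    \<comment> \<open>Induction along a path. Membership in the support is carried along because
      \<open>harmonic_edge\<close> needs it; stationarity preserves it along each edge.\<close>
    then have "y \<in> set_pmf \<nu> \<and> f y = f x"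
    proof induction
      case (step y z)
      then have z: "z \<in> set_pmf (M y)" by (simp add: edges_def set_pmf_iff pmf_positive_iff)
      then have "z \<in> set_pmf (bind_pmf \<nu> M)" using step by auto
      then show ?case
        using harmonic_edge[OF stationary f_bounds harmonic _ z] step by (simp add: stationary)
    qed (use x in simp)
    then show ?thesis ..
  qed
  have "(\<lambda>n. \<Phi> \<nu> (r n)) \<longlonglongrightarrow> (\<integral>x. f x \<partial>\<nu>)"
    unfolding \<Phi>_eq using f \<phi>_bounds by (intro integral_pmf_dominated_convergence[where B = 1]) auto
  moreover have "(\<lambda>n. \<Phi> \<nu> (r n)) \<longlonglongrightarrow> \<gamma>"
    using LIMSEQ_subseq_LIMSEQ[OF tendsto_\<gamma> r] by (simp add: o_def)
  ultimately have "(\<integral>x. f x \<partial>\<nu>) = \<gamma>" by (rule LIMSEQ_unique)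
  moreover have "(\<integral>y. f y \<partial>\<nu>) = (\<integral>y. f x \<partial>\<nu>)"
    using const by (intro integral_cong_AE) (auto simp: AE_measure_pmf_iff)
  ultimately show ?thesis by simp
qed

text \<open>If the deviations stayed away from 0 along a subsequence, compactness would extract from
  it a pointwise limit, equal to \<gamma> on the support, and dominated convergence would give a
  contradiction.\<close>

lemma mean_deviation_tendsto_0: "(\<lambda>n. \<integral>x. \<bar>\<phi> n x - \<gamma>\<bar> \<partial>\<nu>) \<longlonglongrightarrow> 0"
proof (rule ccontr)
  let ?d = "\<lambda>n. \<integral>x. \<bar>\<phi> n x - \<gamma>\<bar> \<partial>\<nu>"
  assume "\<not> ?d \<longlonglongrightarrow> 0"
  then obtain e where e: "e > 0" "\<And>N. \<exists>n\<ge>N. \<bar>?d n\<bar> \<ge> e"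
    unfolding LIMSEQ_iff by (auto simp: not_less)
  have "infinite {n. \<bar>?d n\<bar> \<ge> e}"
    using e(2) by (simp add: infinite_nat_iff_unbounded_le)
  then obtain s :: "nat \<Rightarrow> nat" where s: "strict_mono s" "\<And>n. \<bar>?d (s n)\<bar> \<ge> e"
    using infinite_enumerate by blast
  obtain r f where r: "strict_mono r" "\<And>x. (\<lambda>n. \<phi> (s (r n)) x) \<longlonglongrightarrow> f x"
    using seq_compact_unit_functions[of "\<lambda>n. \<phi> (s n)"] \<phi>_bounds by metis
  have "strict_mono (\<lambda>n. s (r n))"
    using s(1) r(1) by (simp add: strict_mono_def)
  then have f: "f x = \<gamma>" if "x \<in> set_pmf \<nu>" for x
    using subsequential_limit[OF _ r(2) that] by simp
  have "(\<lambda>n. ?d (s (r n))) \<longlonglongrightarrow> (\<integral>x. 0 \<partial>\<nu>)"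
  proof (rule integral_pmf_dominated_convergence)
    show "(\<lambda>n. \<bar>\<phi> (s (r n)) x - \<gamma>\<bar>) \<longlonglongrightarrow> 0" if "x \<in> set_pmf \<nu>" for x
      using tendsto_rabs[OF tendsto_diff[OF r(2)[of x] tendsto_const[of \<gamma>]]] f[OF that] by simp
    show "\<bar>\<bar>\<phi> (s (r n)) x - \<gamma>\<bar>\<bar> \<le> 1" for n x
      using \<phi>_bounds[of "s (r n)" x] \<gamma>_bounds by auto
  qed
  then have "\<forall>\<^sub>F n in sequentially. \<bar>?d (s (r n))\<bar> < e"
    using e(1) by (auto simp: tendsto_iff dist_real_def)
  then show False
    using s(2) by (auto simp: eventually_sequentially not_less[symmetric])
qed

section \<open>Mean square deviation from the limit density\<close>

definition V :: "'a pmf \<Rightarrow> nat \<Rightarrow> real" where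
  "V \<mu> n = (\<integral>w. (G w - \<gamma>)\<^sup>2 \<partial>word_law M \<mu> n)"

lemma deviation_bound: "\<bar>G w - \<gamma>\<bar> \<le> 1"
  using G_bounds[of w] \<gamma>_bounds by auto

lemma sq_deviation_bound: "\<bar>(G w - \<gamma>)\<^sup>2\<bar> \<le> 1"
  using deviation_bound[of w] by (simp add: abs_square_le_1)

lemma integrable_sq_deviation: "integrable (measure_pmf p) (\<lambda>x. (G (h x) - \<gamma>)\<^sup>2)"
  using sq_deviation_bound by (intro integrable_pmf_bounded[where B = 1])

lemma V_bounds: "0 \<le> V \<mu> n" "V \<mu> n \<le> 1"
proof -
  show "0 \<le> V \<mu> n" unfolding V_def by (intro Bochner_Integration.integral_nonneg) auto
  have "V \<mu> n \<le> (\<integral>w. 1 \<partial>word_law M \<mu> n)"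
    unfolding V_def using sq_deviation_bound integrable_sq_deviation[of _ "\<lambda>x. x"] by (intro integral_pmf_mono) auto
  then show "V \<mu> n \<le> 1" by simp
qed

text \<open>Centring at the fixed number \<gamma>, and not at the mean of the word, makes
  \<open>V\<close> an average over initial states.\<close>

lemma V_eq: "V \<mu> n = (\<integral>x. V (return_pmf x) n \<partial>\<mu>)"
  unfolding V_def by (subst word_bind) (rule integral_bind_pmf_bounded, rule sq_deviation_bound)

text \<open>The same coupling as for \<open>\<Phi>\<close>; the factor 2 comes from squaring
  deviations of absolute value at most 1.\<close>

lemma V_add_state: "\<bar>V \<mu> (m + n) - V (state_law M \<mu> m) n\<bar> \<le> 2 * ((c + m) / (m + n))"
  unfolding V_def map_snd_two_words[symmetric] map_append_two_words[symmetric] integral_map_pmf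
proof (rule integral_pmf_diff_le)
  fix p assume p: "p \<in> set_pmf (two_words M \<mu> m n)"
  have "\<bar>(G (fst p @ snd p) - \<gamma>)\<^sup>2 - (G (snd p) - \<gamma>)\<^sup>2\<bar> \<le> 2 * \<bar>G (fst p @ snd p) - G (snd p)\<bar>"
    using sq_diff_le[OF deviation_bound deviation_bound] by force
  then show "\<bar>(G (case p of (u, v) \<Rightarrow> u @ v) - \<gamma>)\<^sup>2 - (G (snd p) - \<gamma>)\<^sup>2\<bar> \<le> 2 * ((c + m) / (m + n))"
    using G_append_right[of "fst p" "snd p"] unfolding set_two_words[OF p] split_def
    by (meson mult_left_mono order_trans zero_le_numeral)
qed (rule integrable_sq_deviation)+

lemma V_add_left: "\<bar>V \<mu> (m + n) - V \<mu> m\<bar> \<le> 2 * ((c + n) / (m + n))"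
  unfolding V_def map_fst_two_words[of M \<mu> m n, symmetric] map_append_two_words[symmetric] integral_map_pmf
proof (rule integral_pmf_diff_le)
  fix p assume p: "p \<in> set_pmf (two_words M \<mu> m n)"
  have "\<bar>(G (fst p @ snd p) - \<gamma>)\<^sup>2 - (G (fst p) - \<gamma>)\<^sup>2\<bar> \<le> 2 * \<bar>G (fst p @ snd p) - G (fst p)\<bar>"
    using sq_diff_le[OF deviation_bound deviation_bound] by force
  then show "\<bar>(G (case p of (u, v) \<Rightarrow> u @ v) - \<gamma>)\<^sup>2 - (G (fst p) - \<gamma>)\<^sup>2\<bar> \<le> 2 * ((c + n) / (m + n))"
    using G_append_left[of "fst p" "snd p"] unfolding set_two_words[OF p] split_def
    by (meson mult_left_mono order_trans zero_le_numeral)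
qed (rule integrable_sq_deviation)+

text \<open>Given the first block and the state \<open>z\<close> that follows it, the second
  deviation has mean \<open>\<phi> n z - \<gamma>\<close>, while the first is at most 1 in absolute
  value. By stationarity \<open>z\<close> has law \<nu>.\<close>

lemma covariance_bound:
  "(\<integral>p. (G (fst p) - \<gamma>) * (G (snd p) - \<gamma>) \<partial>two_words M \<nu> m n) \<le> (\<integral>x. \<bar>\<phi> n x - \<gamma>\<bar> \<partial>\<nu>)"
proof -
  have bd: "\<bar>(G u - \<gamma>) * (G v - \<gamma>)\<bar> \<le> 1" for u v
    using deviation_bound by (simp add: abs_mult mult_le_one)
  have \<phi>_dev: "\<bar>\<phi> n z - \<gamma>\<bar> \<le> 1" for z
    using \<phi>_bounds[of n z] \<gamma>_bounds by auto
  have bd': "\<bar>(G u - \<gamma>) * (\<phi> n z - \<gamma>)\<bar> \<le> 1" for u z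
    using deviation_bound[of u] \<phi>_dev[of z] by (simp add: abs_mult mult_le_one)
  have "(\<integral>p. (G (fst p) - \<gamma>) * (G (snd p) - \<gamma>) \<partial>two_words M \<nu> m n) =
      (\<integral>q. (\<integral>p. (G (fst p) - \<gamma>) * (G (snd p) - \<gamma>) \<partial>map_pmf (Pair (fst q)) (word_law M (return_pmf (snd q)) n))
        \<partial>path_law M \<nu> m)"
    unfolding two_words_def split_def by (rule integral_bind_pmf_bounded, rule bd)
  also have "\<dots> = (\<integral>q. (G (fst q) - \<gamma>) * (\<phi> n (snd q) - \<gamma>) \<partial>path_law M \<nu> m)"
    using integrable_G[of _ "\<lambda>x. x"] by (simp add: \<phi>_def \<Phi>_def)
  also have "\<dots> \<le> (\<integral>q. \<bar>\<phi> n (snd q) - \<gamma>\<bar> \<partial>path_law M \<nu> m)"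
  proof (rule integral_pmf_mono)
    show "integrable (path_law M \<nu> m) (\<lambda>q. (G (fst q) - \<gamma>) * (\<phi> n (snd q) - \<gamma>))"
      by (rule integrable_pmf_bounded, rule bd')
    show "integrable (path_law M \<nu> m) (\<lambda>q. \<bar>\<phi> n (snd q) - \<gamma>\<bar>)"
      using \<phi>_dev by (intro integrable_pmf_bounded[where B = 1]) simp
    fix q
    have "(G (fst q) - \<gamma>) * (\<phi> n (snd q) - \<gamma>) \<le> \<bar>G (fst q) - \<gamma>\<bar> * \<bar>\<phi> n (snd q) - \<gamma>\<bar>"
      by (simp flip: abs_mult)
    also have "\<dots> \<le> 1 * \<bar>\<phi> n (snd q) - \<gamma>\<bar>"
      using deviation_bound by (intro mult_right_mono) auto
    finally show "(G (fst q) - \<gamma>) * (\<phi> n (snd q) - \<gamma>) \<le> \<bar>\<phi> n (snd q) - \<gamma>\<bar>" by simp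
  qed
  also have "\<dots> = (\<integral>x. \<bar>\<phi> n x - \<gamma>\<bar> \<partial>state_law M \<nu> m)"
    by (simp add: state_law_def)
  finally show ?thesis by (simp add: state_stationary[OF stationary])
qed

text \<open>The density of \<open>u @ v\<close> differs from the average of the two densities by at
  most \<open>c / (2 * n)\<close>, and passing to squares doubles this error. The squared average
  yields two terms \<open>V \<nu> n / 4\<close> and half a covariance.\<close>

lemma V_double: "V \<nu> (n + n) \<le> V \<nu> n / 2 + (\<integral>x. \<bar>\<phi> n x - \<gamma>\<bar> \<partial>\<nu>) / 2 + c / n"
proof (cases "n = 0")
  \<comment> \<open>As the empty word has density 0 and \<open>c / 0 = 0\<close>, the claim reads
    \<open>\<gamma>\<^sup>2 \<le> \<gamma>\<^sup>2 / 2 + \<gamma> / 2\<close>.\<close>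
  case True
  then have "V \<nu> 0 = \<gamma>\<^sup>2" 
    by (simp add: V_def word_law_def map_pmf_comp G_def)
  have "(\<integral>x. \<bar>\<phi> 0 x - \<gamma>\<bar> \<partial>\<nu>) = \<gamma>"
    using \<gamma>_bounds by (simp add: \<phi>_def \<Phi>_def word_law_def map_pmf_comp G_def)
  moreover have "\<gamma>\<^sup>2 \<le> \<gamma>"
    using \<gamma>_bounds by (simp add: power2_eq_square mult_left_le)
  ultimately show ?thesis
    using True \<open>V \<nu> 0 = \<gamma>\<^sup>2\<close> by simp
next
  case False
  let ?J = "two_words M \<nu> n n"
  define a where "a p = G (fst p) - \<gamma>" for p :: "'a list \<times> 'a list"
  define b where "b p = G (snd p) - \<gamma>" for p :: "'a list \<times> 'a list"
  have ab: "\<bar>a p\<bar> \<le> 1" "\<bar>b p\<bar> \<le> 1" for p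
    by (simp_all add: a_def b_def deviation_bound)
  have int: "integrable (measure_pmf ?J) (\<lambda>p. (a p)\<^sup>2)" "integrable (measure_pmf ?J) (\<lambda>p. (b p)\<^sup>2)" "integrable (measure_pmf ?J) (\<lambda>p. a p * b p)"
    using ab by (intro integrable_pmf_bounded[where B = 1], simp add: abs_square_le_1 abs_mult mult_le_one)+
  have "V \<nu> (n + n) = (\<integral>p. (G (fst p @ snd p) - \<gamma>)\<^sup>2 \<partial>measure_pmf ?J)"
    by (simp add: V_def map_append_two_words[symmetric] split_def)
  also have "\<dots> \<le> (\<integral>p. (a p)\<^sup>2 / 4 + (b p)\<^sup>2 / 4 + a p * b p / 2 + c / n \<partial>measure_pmf ?J)"
  proof (rule integral_pmf_mono)
    fix p assume "p \<in> set_pmf ?J"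
    then have len: "length (fst p) = n" "length (snd p) = n" by (rule set_two_words)+
    have "2 * n * \<bar>(G (fst p @ snd p) - \<gamma>) - (a p + b p) / 2\<bar> =
        \<bar>(n + n) * G (fst p @ snd p) - n * G (fst p) - n * G (snd p)\<bar>"
    proof -
      have "2 * real n * ((G (fst p @ snd p) - \<gamma>) - (a p + b p) / 2) =
          (n + n) * G (fst p @ snd p) - n * G (fst p) - n * G (snd p)"
        by (simp add: a_def b_def field_simps)
      then show ?thesis
        using abs_mult[of "2 * real n" "(G (fst p @ snd p) - \<gamma>) - (a p + b p) / 2"] by simp
    qed
    also have "\<dots> \<le> c"
      using G_append_sum[of "fst p" "snd p"] by (simp add: len)
    finally have "2 * \<bar>(G (fst p @ snd p) - \<gamma>) - (a p + b p) / 2\<bar> \<le> c / n"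
      using False by (simp add: field_simps)
    moreover have "\<bar>(a p + b p) / 2\<bar> \<le> 1" using ab[of p] by (auto simp: abs_le_iff)
    ultimately have "(G (fst p @ snd p) - \<gamma>)\<^sup>2 - ((a p + b p) / 2)\<^sup>2 \<le> c / n"
      using sq_diff_le[OF deviation_bound[of "fst p @ snd p"], of "(a p + b p) / 2"] by linarith
    then show "(G (fst p @ snd p) - \<gamma>)\<^sup>2 \<le> (a p)\<^sup>2 / 4 + (b p)\<^sup>2 / 4 + a p * b p / 2 + c / n"
      by (simp add: power2_eq_square field_simps)
  qed (use int integrable_sq_deviation in auto)
  also have "\<dots> = (\<integral>p. (a p)\<^sup>2 \<partial>measure_pmf ?J) / 4 + (\<integral>p. (b p)\<^sup>2 \<partial>measure_pmf ?J) / 4 + (\<integral>p. a p * b p \<partial>measure_pmf ?J) / 2 + c / n"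
    using int by simp
  also have "(\<integral>p. (a p)\<^sup>2 \<partial>measure_pmf ?J) = V \<nu> n"
    by (simp add: V_def a_def map_fst_two_words[of M \<nu> n n, symmetric])
  also have "(\<integral>p. (b p)\<^sup>2 \<partial>measure_pmf ?J) = V \<nu> n"
    using map_snd_two_words[of M \<nu> n n, symmetric]
    by (simp add: V_def b_def state_stationary[OF stationary])
  finally show ?thesis
    using covariance_bound[of n n] by (simp add: a_def b_def)
qed

lemma V_stationary_tendsto_0: "V \<nu> \<longlonglongrightarrow> 0"
proof -
  define d0 where "d0 n = (\<integral>x. \<bar>\<phi> n x - \<gamma>\<bar> \<partial>\<nu>) / 2 + c / n" for n
  \<comment> \<open>The last summand pays for deleting the last letter of a word of odd
    length.\<close>
  define d where "d n = d0 (n div 2) + 2 * ((c + 1) / n)" for n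
  have d0: "d0 \<longlonglongrightarrow> 0"
    unfolding d0_def using tendsto_add[OF tendsto_divide[OF mean_deviation_tendsto_0 tendsto_const[of 2]] lim_const_over_n[of c]]
    by simp
  have "filterlim (\<lambda>n::nat. n div 2) at_top sequentially"
    unfolding filterlim_at_top by (metis (no_types, lifting) div_le_mono eventually_at_top_linorder
        nonzero_mult_div_cancel_left zero_neq_numeral)
  then have "(\<lambda>n. d0 (n div 2)) \<longlonglongrightarrow> 0"
    by (rule filterlim_compose[OF d0])
  then have "d \<longlonglongrightarrow> 0"
    unfolding d_def using tendsto_add[OF _ tendsto_mult[OF tendsto_const[of 2] lim_const_over_n[of "c + 1"]]] by force
  moreover have "V \<nu> n \<le> V \<nu> (n div 2) / 2 + d n" for n
  proof (cases "even n")
    case True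
    then have "n div 2 + n div 2 = n" by auto
    then show ?thesis
      using V_double[of "n div 2"] c_nonneg
      by (simp add: d_def d0_def add.assoc[symmetric] add_increasing2)
  next
    case False
    define k where "k = n div 2"
    have n: "n = k + k + 1" using False by (auto simp: k_def elim: oddE)
    show ?thesis
      using V_double[of k] V_add_left[of \<nu> "k + k" 1] unfolding d_def k_def[symmetric] d0_def
      by (simp add: n)
  qed
  ultimately show ?thesis
    using V_bounds by (intro halving_recursion_tendsto_0[of "V \<nu>" 1 d]) auto
qed

section \<open>Arbitrary initial distributions\<close>

lemma V_state_tendsto_0:
  assumes "x \<in> set_pmf \<nu>"
  shows "(\<lambda>n. V (return_pmf x) n) \<longlonglongrightarrow> 0"
proof (rule Lim_null_comparison)
  have pos: "pmf \<nu> x > 0" using assms by (simp add: pmf_positive)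
  \<comment> \<open>The state \<open>x\<close> contributes one nonnegative term to the average that
    defines \<open>V \<nu> n\<close>, with positive weight.\<close>
  have "V (return_pmf x) n \<le> V \<nu> n / pmf \<nu> x" for n
    using pmf_times_le_integral[of "\<lambda>x. V (return_pmf x) n" 1 \<nu> x] V_bounds pos
    by (simp add: V_eq[of \<nu>] field_simps)
  then show "\<forall>\<^sub>F n in sequentially. norm (V (return_pmf x) n) \<le> V \<nu> n / pmf \<nu> x"
    using V_bounds by simp
  show "(\<lambda>n. V \<nu> n / pmf \<nu> x) \<longlonglongrightarrow> 0"
    using tendsto_divide[OF V_stationary_tendsto_0 tendsto_const[of "pmf \<nu> x"]] pos by simp
qed

text \<open>At a late time \<open>t\<close> the chain is in the support up to a small probability.
  From states there \<open>V\<close> tends to 0 with dominated convergence, from other states it is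
  at most 1, and discarding the first \<open>t\<close> letters is negligible for long words.\<close>

lemma V_tendsto_0:
  assumes hit: "(\<lambda>t. measure (state_law M \<mu> t) (- set_pmf \<nu>)) \<longlonglongrightarrow> 0"
  shows "V \<mu> \<longlonglongrightarrow> 0"
proof (rule LIMSEQ_I)
  fix r :: real assume "r > 0"
  \<comment> \<open>One third each for starting states outside the support, for those inside it, and
    for the discarded letters.\<close>
  define e where "e = r / 3"
  have "e > 0" using \<open>r > 0\<close> by (simp add: e_def)
  obtain t where t: "measure (state_law M \<mu> t) (- set_pmf \<nu>) < e"
    using order_tendstoD(2)[OF hit \<open>e > 0\<close>] by (auto simp: eventually_sequentially)
  define h where "h n x = indicator (set_pmf \<nu>) x * V (return_pmf x) n" for n x
  have "(\<lambda>n. \<integral>x. h n x \<partial>state_law M \<mu> t) \<longlonglongrightarrow> (\<integral>x. 0 \<partial>state_law M \<mu> t)"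
    using V_state_tendsto_0 V_bounds unfolding h_def
    by (intro integral_pmf_dominated_convergence[where B = 1]) (auto split: split_indicator)
  then have "\<forall>\<^sub>F n in sequentially. (\<integral>x. h n x \<partial>state_law M \<mu> t) < e"
    using \<open>e > 0\<close> order_tendstoD(2) by fastforce
  moreover have "\<forall>\<^sub>F n in sequentially. 2 * ((c + t) / real (n + t)) < e"
    using order_tendstoD(2)[OF tendsto_mult[OF tendsto_const[of 2] tendsto_const_over_add[of "c + t" t]], of e] \<open>e > 0\<close>
    by simp
  ultimately have "\<forall>\<^sub>F n in sequentially. V \<mu> (n + t) < r"
  proof eventually_elim
    case (elim n)
    have "V (state_law M \<mu> t) n \<le> (\<integral>x. h n x + indicator (- set_pmf \<nu>) x \<partial>state_law M \<mu> t)"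
      unfolding V_eq[of "state_law M \<mu> t"] h_def
      using V_bounds order_trans[OF V_bounds(2), of 2]
      by (intro integral_pmf_mono integrable_pmf_bounded[where B = 2]) (auto split: split_indicator)
    also have "\<dots> = (\<integral>x. h n x \<partial>state_law M \<mu> t) + measure (state_law M \<mu> t) (- set_pmf \<nu>)"
    proof -
      have "integrable (state_law M \<mu> t) (h n)"
        unfolding h_def using V_bounds by (intro integrable_pmf_bounded[where B = 1]) (auto split: split_indicator)
      moreover have "integrable (state_law M \<mu> t) (indicat_real (- set_pmf \<nu>))"
        by (intro integrable_pmf_bounded[where B = 1]) (auto split: split_indicator)
      ultimately show ?thesis by simp
    qed
    also have "\<dots> < 2 * e" using elim(1) t by simp
    finally show ?case
      using V_add_state[of \<mu> t n] elim(2) unfolding e_def add.commute[of t n] abs_le_iff by linarith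
  qed
  then obtain N where N: "\<And>n. n \<ge> N \<Longrightarrow> V \<mu> (n + t) < r" by (auto simp: eventually_sequentially)
  have "norm (V \<mu> n - 0) < r" if "n \<ge> N + t" for n
    using N[of "n - t"] that V_bounds[of \<mu> n] by simp
  then show "\<exists>N. \<forall>n\<ge>N. norm (V \<mu> n - 0) < r" by blast
qed

end

section \<open>Trajectories\<close>

text \<open>The definition of \<open>stationary\<close> uses an infinite sum,
  \<open>bind_pmf\<close> an expectation; absolute summability, by comparison with
  \<open>pmf \<nu>\<close>, identifies the two.\<close>

lemma bind_pmf_stationary:
  assumes "stationary M \<nu>"
  shows "bind_pmf \<nu> M = \<nu>"
proof (rule pmf_eqI)
  fix x
  have "Infinite_Set_Sum.abs_summable_on (\<lambda>y. pmf \<nu> y * pmf (M y) x) UNIV"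
    by (rule abs_summable_on_comparison_test'[OF pmf_abs_summable[of \<nu>]])
      (auto simp: pmf_le_1 intro: mult_left_le)
  then have "pmf (bind_pmf \<nu> M) x = (\<Sum>\<^sub>\<infinity>y. pmf \<nu> y * pmf (M y) x)"
    by (simp add: pmf_bind pmf_expectation_eq_infsetsum infsetsum_infsum)
  then show "pmf (bind_pmf \<nu> M) x = pmf \<nu> x"
    using assms by (simp add: stationary_def mult.commute)
qed

text \<open>The last letter of the longer word is the former next state, so only one intermediate
  pair contributes.\<close>

lemma pmf_path_Suc: "pmf (path_law M \<mu> (Suc n)) (l @ [z], y) = pmf (path_law M \<mu> n) (l, z) * pmf (M z) y"
proof -
  have "pmf (map_pmf (Pair (fst q @ [snd q])) (M (snd q))) (l @ [z], y) = indicator {(l, z)} q * pmf (M z) y" for q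
  proof (cases "q = (l, z)")
    case True
    then show ?thesis by (simp add: pmf_map_inj' inj_def)
  next
    case False
    then show ?thesis by (cases q) (auto simp: pmf_eq_0_set_pmf)
  qed
  then show ?thesis
    by (simp add: pmf_bind split_def measure_pmf_single)
qed

section \<open>Laws of trajectories and entrance into the terminal component\<close>

context
  fixes M :: "'a::countable \<Rightarrow> 'a pmf" and \<mu> :: "'a pmf" and \<Omega> :: "'b measure" and X :: "nat \<Rightarrow> 'b \<Rightarrow> 'a"
  assumes trajectory: "trajectory M \<mu> \<Omega> X"
begin

interpretation prob_space \<Omega>
  using trajectory by (simp add: trajectory_def)

lemma measurable_trajectory [measurable]: "X n \<in> measurable \<Omega> (count_space UNIV)"
  using trajectory by (simp add: trajectory_def)

lemma cond_prob_trajectory: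
  assumes "1 \<le> n" "\<P>(\<omega> in \<Omega>. \<forall>k<n. X k \<omega> = x k) > 0"
  shows "\<P>(\<omega> in \<Omega>. X n \<omega> = x n \<bar> \<forall>k<n. X k \<omega> = x k) = pmf (M (x (n - 1))) (x n)"
  using trajectory[unfolded trajectory_def, THEN conjunct2, THEN conjunct2, THEN conjunct2] assms
  by blast

lemma prob_trajectory:
  "\<P>(\<omega> in \<Omega>. map (\<lambda>i. X i \<omega>) [0..<n] = l \<and> X n \<omega> = z) = pmf (path_law M \<mu> n) (l, z)"
proof (induction n arbitrary: l z)
  case 0
  show ?case
  proof (cases "l = []")
    case True
    then show ?thesis
      using trajectory by (simp add: trajectory_def pmf_map_inj' inj_def)
  next
    case False
    then have "([]::'a list) \<noteq> l" by auto
    with False show ?thesis by (auto simp: pmf_eq_0_set_pmf)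
  qed
next
  case (Suc n)
  show ?case
  proof (cases "length l = Suc n")
    case False
    then have "map (\<lambda>i. X i \<omega>) [0..<Suc n] \<noteq> l" for \<omega>
      by (metis diff_zero length_map length_upt)
    moreover have "(l, z) \<notin> set_pmf (path_law M \<mu> (Suc n))"
      using False length_path by metis
    ultimately show ?thesis
      by (simp add: pmf_eq_0_set_pmf del: upt_Suc path_law.simps)
  next
    case True
    then obtain u y where l: "l = u @ [y]" and u: "length u = n"
      by (metis length_Suc_conv_rev)
    \<comment> \<open>Past and next state are combined into one sequence, the form in which
      \<open>trajectory\<close> states its conditional probabilities.\<close>
    define x where "x k = (if k \<le> n then l ! k else z)" for k
    have past: "map (\<lambda>i. X i \<omega>) [0..<n] = u \<and> X n \<omega> = y \<longleftrightarrow> (\<forall>k<Suc n. X k \<omega> = x k)" for \<omega>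
      by (auto simp: x_def l u nth_append less_Suc_eq list_eq_iff_nth_eq)
    have event: "map (\<lambda>i. X i \<omega>) [0..<Suc n] = l \<and> X (Suc n) \<omega> = z \<longleftrightarrow>
        X (Suc n) \<omega> = x (Suc n) \<and> (\<forall>k<Suc n. X k \<omega> = x k)" for \<omega>
      unfolding past[symmetric] by (auto simp: l x_def)
    have IH: "\<P>(\<omega> in \<Omega>. \<forall>k<Suc n. X k \<omega> = x k) = pmf (path_law M \<mu> n) (u, y)"
      using Suc.IH[of u y] by (simp only: past)
    have "\<P>(\<omega> in \<Omega>. X (Suc n) \<omega> = x (Suc n) \<and> (\<forall>k<Suc n. X k \<omega> = x k)) =
        pmf (path_law M \<mu> n) (u, y) * pmf (M y) z"
    \<comment> \<open>Conditional probabilities are prescribed only for pasts of positive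
      probability; for a null past both sides are 0.\<close>
    proof (cases "\<P>(\<omega> in \<Omega>. \<forall>k<Suc n. X k \<omega> = x k) > 0")
      case True
      then have "\<P>(\<omega> in \<Omega>. X (Suc n) \<omega> = x (Suc n) \<bar> \<forall>k<Suc n. X k \<omega> = x k) = pmf (M (x n)) (x (Suc n))"
        using cond_prob_trajectory[of "Suc n" x] by simp
      moreover have "x n = y" "x (Suc n) = z"
        by (simp_all add: x_def l u nth_append)
      ultimately show ?thesis
        using True by (simp add: cond_prob_def IH divide_eq_eq mult.commute)
    next
      case False
      then have zero: "\<P>(\<omega> in \<Omega>. \<forall>k<Suc n. X k \<omega> = x k) = 0"
        by (simp add: zero_less_measure_iff)
      have "\<P>(\<omega> in \<Omega>. X (Suc n) \<omega> = x (Suc n) \<and> (\<forall>k<Suc n. X k \<omega> = x k))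
          \<le> \<P>(\<omega> in \<Omega>. \<forall>k<Suc n. X k \<omega> = x k)"
        by (intro finite_measure_mono) auto
      then have "\<P>(\<omega> in \<Omega>. X (Suc n) \<omega> = x (Suc n) \<and> (\<forall>k<Suc n. X k \<omega> = x k)) = 0"
        using zero by (simp add: measure_le_0_iff)
      then show ?thesis
        using zero by (simp add: IH)
    qed
    then show ?thesis
      unfolding event by (simp only: l pmf_path_Suc)
  qed
qed

lemma measurable_path:
  "(\<lambda>\<omega>. (map (\<lambda>i. X i \<omega>) [0..<n], X n \<omega>)) \<in> measurable \<Omega> (count_space UNIV)"
proof (subst measurable_count_space_eq_countable)
  have "{\<omega> \<in> space \<Omega>. map (\<lambda>i. X i \<omega>) [0..<n] = l \<and> X n \<omega> = z} \<in> sets \<Omega>" for l z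
    by (simp add: list_eq_iff_nth_eq)
  then have "(\<lambda>\<omega>. (map (\<lambda>i. X i \<omega>) [0..<n], X n \<omega>)) -` {a} \<inter> space \<Omega> \<in> sets \<Omega>" for a
    by (cases a) (simp add: vimage_def Int_def conj_commute)
  then show "(\<lambda>\<omega>. (map (\<lambda>i. X i \<omega>) [0..<n], X n \<omega>)) \<in> space \<Omega> \<rightarrow> UNIV \<and>
      (\<forall>a\<in>UNIV. (\<lambda>\<omega>. (map (\<lambda>i. X i \<omega>) [0..<n], X n \<omega>)) -` {a} \<inter> space \<Omega> \<in> sets \<Omega>)"
    by blast
qed simp

lemma distr_path:
  "distr \<Omega> (count_space UNIV) (\<lambda>\<omega>. (map (\<lambda>i. X i \<omega>) [0..<n], X n \<omega>)) = measure_pmf (path_law M \<mu> n)"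
proof (rule measure_eqI_countable)
  fix a
  have "(\<lambda>\<omega>. (map (\<lambda>i. X i \<omega>) [0..<n], X n \<omega>)) -` {a} \<inter> space \<Omega> =
      {\<omega> \<in> space \<Omega>. map (\<lambda>i. X i \<omega>) [0..<n] = fst a \<and> X n \<omega> = snd a}"
    by auto
  then show "emeasure (distr \<Omega> (count_space UNIV) (\<lambda>\<omega>. (map (\<lambda>i. X i \<omega>) [0..<n], X n \<omega>))) {a} =
      emeasure (measure_pmf (path_law M \<mu> n)) {a}"
    by (simp add: emeasure_distr[OF measurable_path] emeasure_eq_measure prob_trajectory emeasure_pmf_single)
qed auto

lemma prob_path:
  "\<P>(\<omega> in \<Omega>. Q (map (\<lambda>i. X i \<omega>) [0..<n]) (X n \<omega>)) = measure (path_law M \<mu> n) {a. Q (fst a) (snd a)}"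
proof -
  have "measure (path_law M \<mu> n) {a. Q (fst a) (snd a)} =
      measure \<Omega> ((\<lambda>\<omega>. (map (\<lambda>i. X i \<omega>) [0..<n], X n \<omega>)) -` {a. Q (fst a) (snd a)} \<inter> space \<Omega>)"
    unfolding distr_path[symmetric] by (rule measure_distr[OF measurable_path]) simp
  then show ?thesis
    by (simp add: vimage_def Int_def conj_commute)
qed

text \<open>The visiting condition of \<open>EPRI_with\<close> concerns sample spaces of sequences
  only. The law of the process lives there, and the defining conditions of a trajectory, which
  involve finitely many coordinates at a time, carry over.\<close>

lemma trajectory_canonical:
  "trajectory M \<mu> (distr \<Omega> (PiM UNIV (\<lambda>_. count_space UNIV)) (\<lambda>\<omega> i. X i \<omega>)) (\<lambda>i \<omega>. \<omega> i)"
    (is "trajectory M \<mu> ?\<Omega> _")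
proof -
  have X [measurable]: "(\<lambda>\<omega> i. X i \<omega>) \<in> measurable \<Omega> (PiM UNIV (\<lambda>_. count_space UNIV))"
    by (rule measurable_PiM_single') auto
  have prob: "\<P>(\<omega> in ?\<Omega>. Q \<omega>) = \<P>(\<omega> in \<Omega>. Q (\<lambda>i. X i \<omega>))"
    if "{\<omega> \<in> space (PiM UNIV (\<lambda>_. count_space UNIV)). Q \<omega>} \<in> sets (PiM UNIV (\<lambda>_. count_space UNIV))"
    for Q :: "(nat \<Rightarrow> 'a) \<Rightarrow> bool"
  proof -
    have "\<P>(\<omega> in ?\<Omega>. Q \<omega>) = measure ?\<Omega> {\<omega> \<in> space (PiM UNIV (\<lambda>_. count_space UNIV)). Q \<omega>}"
      by simp
    also have "\<dots> = \<P>(\<omega> in \<Omega>. Q (\<lambda>i. X i \<omega>))"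
      by (subst measure_distr[OF X that]) (auto simp: space_PiM intro!: arg_cong[where f = prob])
    finally show ?thesis .
  qed
  show ?thesis
    unfolding trajectory_def cond_prob_def
  proof (intro conjI allI impI)
    show "prob_space ?\<Omega>"
      by (rule prob_space_distr[OF X])
    show "(\<lambda>\<omega>. \<omega> n) \<in> measurable ?\<Omega> (count_space UNIV)" for n
      by simp
    show "\<P>(\<omega> in ?\<Omega>. \<omega> 0 = x) = pmf \<mu> x" for x
      using trajectory by (subst prob) (auto simp: trajectory_def)
    fix n :: nat and x :: "nat \<Rightarrow> 'a"
    assume n: "1 \<le> n" and pos: "0 < \<P>(\<omega> in ?\<Omega>. \<forall>k<n. \<omega> k = x k)"
    have past: "\<P>(\<omega> in ?\<Omega>. \<forall>k<n. \<omega> k = x k) = \<P>(\<omega> in \<Omega>. \<forall>k<n. X k \<omega> = x k)"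
      by (subst prob) auto
    have "\<P>(\<omega> in ?\<Omega>. \<omega> n = x n \<and> (\<forall>k<n. \<omega> k = x k)) = \<P>(\<omega> in \<Omega>. X n \<omega> = x n \<and> (\<forall>k<n. X k \<omega> = x k))"
      by (subst prob) auto
    then show "\<P>(\<omega> in ?\<Omega>. \<omega> n = x n \<and> (\<forall>k<n. \<omega> k = x k)) / \<P>(\<omega> in ?\<Omega>. \<forall>k<n. \<omega> k = x k) = pmf (M (x (n - 1))) (x n)"
      using cond_prob_trajectory[OF n, of x] pos unfolding cond_prob_def past by simp
  qed
qed

lemma AE_visits:
  assumes "EPRI_with M C"
  shows "AE \<omega> in \<Omega>. \<exists>n. X n \<omega> \<in> C"
proof -
  have X: "(\<lambda>\<omega> i. X i \<omega>) \<in> measurable \<Omega> (PiM UNIV (\<lambda>_. count_space UNIV))"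
    by (rule measurable_PiM_single') auto
  have "AE \<omega> in distr \<Omega> (PiM UNIV (\<lambda>_. count_space UNIV)) (\<lambda>\<omega> i. X i \<omega>). \<exists>n. \<omega> n \<in> C"
    using assms trajectory_canonical unfolding EPRI_with_def by blast
  then show ?thesis
    by (rule AE_distrD[OF X])
qed

lemma path_stays:
  assumes closed: "\<And>x y. x \<in> C \<Longrightarrow> y \<in> set_pmf (M x) \<Longrightarrow> y \<in> C"
  shows "(l, z) \<in> set_pmf (path_law M \<mu> n) \<Longrightarrow> x \<in> set l \<Longrightarrow> x \<in> C \<Longrightarrow> z \<in> C"
proof (induction n arbitrary: l z)
  case (Suc n)
  then obtain u y where u: "(u, y) \<in> set_pmf (path_law M \<mu> n)" "l = u @ [y]" "z \<in> set_pmf (M y)"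
    by auto
  then have "y \<in> C" using Suc by auto
  then show ?case using closed u(3) by blast
qed auto

text \<open>Since \<open>C\<close> is closed, being outside it at time \<open>t\<close> means,
  almost surely, not having visited it before. The events \<open>A t\<close> increase to the event
  of a visit, which has probability 1.\<close>

lemma state_outside_tendsto_0:
  assumes "EPRI_with M C" and closed: "\<And>x y. x \<in> C \<Longrightarrow> y \<in> set_pmf (M x) \<Longrightarrow> y \<in> C"
  shows "(\<lambda>t. measure (state_law M \<mu> t) (- C)) \<longlonglongrightarrow> 0"
proof -
  define A where "A t = {\<omega> \<in> space \<Omega>. \<exists>k\<le>t. X k \<omega> \<in> C}" for t
  have A [measurable]: "A t \<in> sets \<Omega>" for t
    unfolding A_def by measurable
  have "incseq A"
    by (auto simp: A_def incseq_def intro: order_trans)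
  then have "(\<lambda>t. prob (A t)) \<longlonglongrightarrow> prob (\<Union>t. A t)"
    using A by (intro finite_Lim_measure_incseq) auto
  moreover have "prob (\<Union>t. A t) = 1"
    using AE_visits[OF assms(1)] A by (subst prob_eq_1) (auto simp: A_def elim!: eventually_mono)
  ultimately have lim: "(\<lambda>t. 1 - prob (A t)) \<longlonglongrightarrow> 0"
    using tendsto_diff[OF tendsto_const[of 1]] by fastforce
  have stays: "z \<in> C" if "(l, z) \<in> set_pmf (path_law M \<mu> t)" "x \<in> set l" "x \<in> C" for l x z t
    using closed that by (rule path_stays)
  have le: "measure (state_law M \<mu> t) (- C) \<le> 1 - prob (A t)" for t
  proof -
    have "measure (state_law M \<mu> t) (- C) = measure (path_law M \<mu> t) {a. snd a \<notin> C}"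
      by (simp add: state_law_def vimage_def Compl_eq)
    \<comment> \<open>Requiring that no earlier state lies in \<open>C\<close> changes only a null
      set, by closedness.\<close>
    also have "\<dots> = measure (path_law M \<mu> t) {a. snd a \<notin> C \<and> (\<forall>x\<in>set (fst a). x \<notin> C)}"
      by (intro measure_pmf.finite_measure_eq_AE) (auto simp: AE_measure_pmf_iff dest: stays)
    also have "\<dots> = \<P>(\<omega> in \<Omega>. X t \<omega> \<notin> C \<and> (\<forall>x\<in>set (map (\<lambda>i. X i \<omega>) [0..<t]). x \<notin> C))"
      by (rule prob_path[symmetric])
    also have "\<dots> \<le> prob (space \<Omega> - A t)"
      by (intro finite_measure_mono) (auto simp: A_def le_less)
    also have "\<dots> = 1 - prob (A t)"
      by (rule prob_compl[OF A])
    finally show ?thesis .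
  qed
  show ?thesis
    by (rule Lim_null_comparison[OF _ lim]) (simp add: le)
qed

end

lemma EPRI_with_stationary:
  assumes "EPRI_with M C"
  obtains \<nu> where "bind_pmf \<nu> M = \<nu>" "set_pmf \<nu> = C"
    "\<And>x y. x \<in> C \<Longrightarrow> y \<in> C \<Longrightarrow> (x, y) \<in> (edges M)\<^sup>*"
proof -
  obtain \<nu> where \<nu>: "stationary M \<nu>" "\<forall>x\<in>C. pmf \<nu> x > 0" "\<forall>x\<in>-C. pmf \<nu> x = 0"
    using assms unfolding EPRI_with_def by blast
  have "set_pmf \<nu> = C"
    using \<nu>(2,3) by (auto simp: set_pmf_iff)
  moreover have "(x, y) \<in> (edges M)\<^sup>*" if "x \<in> C" "y \<in> C" for x y
    using assms that unfolding EPRI_with_def strongly_connected_component_def quotient_def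
    by (auto intro: rtrancl_trans)
  ultimately show thesis
    using that bind_pmf_stationary[OF \<nu>(1)] by blast
qed

section \<open>The law of large numbers\<close>

context stationary_chain_functional
begin

lemma convergence_in_probability:
  assumes "V \<mu> \<longlonglongrightarrow> 0"
  obtains \<epsilon> where "\<epsilon> \<longlonglongrightarrow> 0" "\<And>n. measure (word_law M \<mu> n) {w. \<bar>G w - \<gamma>\<bar> \<ge> \<epsilon> n} \<le> \<epsilon> n"
proof
  \<comment> \<open>Chebyshev's inequality gives the bound
    \<open>V \<mu> n / (\<epsilon> n)\<^sup>2\<close>, which is at most \<open>\<epsilon> n\<close>
    once \<open>V \<mu> n \<le> \<epsilon> n ^ 3\<close>, whence the cube root. The second term
    keeps \<open>\<epsilon> n\<close> positive.\<close>
  define \<epsilon> where "\<epsilon> n = root 3 (V \<mu> n) + 1 / Suc n" for n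
  show "\<epsilon> \<longlonglongrightarrow> 0"
    unfolding \<epsilon>_def using tendsto_add[OF tendsto_real_root[OF assms, of 3] LIMSEQ_Suc[OF lim_const_over_n[of 1]]]
    by simp
  fix n
  have root: "root 3 (V \<mu> n) \<ge> 0" using V_bounds by simp
  then have pos: "\<epsilon> n > 0" by (simp add: \<epsilon>_def add_nonneg_pos)
  have "V \<mu> n = root 3 (V \<mu> n) ^ 3" using V_bounds by simp
  also have "\<dots> \<le> \<epsilon> n ^ 3" using root by (intro power_mono) (auto simp: \<epsilon>_def)
  finally have "V \<mu> n \<le> \<epsilon> n ^ 3" .
  have "measure (word_law M \<mu> n) {w. \<bar>G w - \<gamma>\<bar> \<ge> \<epsilon> n} \<le> V \<mu> n / (\<epsilon> n)\<^sup>2"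
    using measure_pmf.second_moment_method[of "\<lambda>w. G w - \<gamma>" "word_law M \<mu> n" "\<epsilon> n"] pos
      integrable_sq_deviation[of _ "\<lambda>x. x"] by (simp add: V_def)
  also have "\<dots> \<le> \<epsilon> n ^ 3 / (\<epsilon> n)\<^sup>2"
    using \<open>V \<mu> n \<le> \<epsilon> n ^ 3\<close> by (intro divide_right_mono) auto
  also have "\<dots> = \<epsilon> n"
    using pos by (simp add: power2_eq_square power3_eq_cube)
  finally show "measure (word_law M \<mu> n) {w. \<bar>G w - \<gamma>\<bar> \<ge> \<epsilon> n} \<le> \<epsilon> n" .
qed

end

text \<open>Only the law of the word of each length matters, so every \<open>n\<close> may have its
  own sample space; the limit and the rates are obtained from \<open>word_law\<close> alone.\<close>

theorem almost_additive_law_of_large_numbers: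
  fixes M :: "'a::countable \<Rightarrow> 'a pmf" and F :: "'a list \<Rightarrow> real"
  assumes EPRI: "EPRI M" and traj: "\<And>n. trajectory M \<mu> (\<Omega> n) (X n)"
    and F: "\<And>w. 0 \<le> F w" "\<And>w. F w \<le> length w" "almost_additive c F"
  shows "\<exists>\<gamma> \<epsilon>. \<epsilon> \<longlonglongrightarrow> 0 \<and> (\<forall>n. \<P>(\<omega> in \<Omega> n. \<bar>F (map (\<lambda>i. X n i \<omega>) [0..<n]) / n - \<gamma>\<bar> \<ge> \<epsilon> n) \<le> \<epsilon> n)"
proof -
  obtain C where C: "EPRI_with M C" using EPRI by (auto simp: EPRI_def)
  then obtain \<nu> where \<nu>: "bind_pmf \<nu> M = \<nu>" "set_pmf \<nu> = C"
    "\<And>x y. x \<in> C \<Longrightarrow> y \<in> C \<Longrightarrow> (x, y) \<in> (edges M)\<^sup>*"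
    by (rule EPRI_with_stationary) blast
  interpret stationary_chain_functional F c M \<nu>
    using F \<nu> by unfold_locales auto
  \<comment> \<open>A successor of a state in the support of \<nu> receives positive mass after one
    step, and this step preserves \<nu>; hence the component is closed.\<close>
  have "y \<in> C" if "x \<in> C" "y \<in> set_pmf (M x)" for x y
  proof -
    have "y \<in> set_pmf (bind_pmf \<nu> M)" using that \<nu>(2) by auto
    then show ?thesis by (simp add: \<nu>)
  qed
  then have "V \<mu> \<longlonglongrightarrow> 0"
    using state_outside_tendsto_0[OF traj C] by (intro V_tendsto_0) (simp add: \<nu>(2))
  then obtain \<epsilon> where \<epsilon>: "\<epsilon> \<longlonglongrightarrow> 0" "\<And>n. measure (word_law M \<mu> n) {w. \<bar>G w - \<gamma>\<bar> \<ge> \<epsilon> n} \<le> \<epsilon> n"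
    by (rule convergence_in_probability) blast
  have "\<P>(\<omega> in \<Omega> n. \<bar>F (map (\<lambda>i. X n i \<omega>) [0..<n]) / n - \<gamma>\<bar> \<ge> \<epsilon> n) =
      measure (word_law M \<mu> n) {w. \<bar>G w - \<gamma>\<bar> \<ge> \<epsilon> n}" for n
    using prob_path[OF traj, of n "\<lambda>w _. \<bar>G w - \<gamma>\<bar> \<ge> \<epsilon> n" n]
    by (simp add: G_def word_law_def vimage_def)
  then show ?thesis
    using \<epsilon> by (intro exI[of _ \<gamma>] exI[of _ \<epsilon>]) simp
qed

theorem theorem7:
  fixes M :: "'a::{countable,linorder} \<Rightarrow> 'a pmf"
    and \<mu> :: "'a pmf"
    and \<Omega> :: "nat \<Rightarrow> 'b measure"
    and X :: "nat \<Rightarrow> nat \<Rightarrow> 'b \<Rightarrow> 'a"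
    and W :: "nat \<Rightarrow> 'b \<Rightarrow> 'a list"
  assumes "EPRI M"
    and "\<And>n. trajectory M \<mu> (\<Omega> n) (X n)"
    and "(\<forall>n. \<forall>\<omega>\<in>space (\<Omega> n). generated_left_to_right (\<lambda>i. X n i \<omega>) n (W n \<omega>)) \<or>
         (\<forall>n. \<forall>\<omega>\<in>space (\<Omega> n). generated_right_to_left (\<lambda>i. X n i \<omega>) n (W n \<omega>))"
  shows "\<forall>k. \<exists>(\<gamma>::real) (\<epsilon> :: nat \<Rightarrow> real). \<epsilon> \<longlonglongrightarrow> 0 \<and>
           (\<forall>n. \<P>(\<omega> in \<Omega> n. \<bar>real (length_is_iter k (W n \<omega>)) / real (length (W n \<omega>)) - \<gamma>\<bar> \<ge> \<epsilon> n) \<le> \<epsilon> n)"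
proof
  fix k
  define L where "L w = real (length_is_iter k w)" for w :: "'a list"
  obtain c where "almost_additive c (\<lambda>w :: 'a list. real (length_is_iter k w))"
    by (rule almost_additive_length_is_iter)
  then have L: "almost_additive c L" "\<And>w. 0 \<le> L w" "\<And>w. L w \<le> length w"
    by (simp_all add: L_def[abs_def] length_is_iter_le)
  \<comment> \<open>Both directions are reduced to words read from left to right along the
    trajectory, with \<open>F\<close> being \<open>L\<close> or its composition with
    \<open>rev\<close>.\<close>
  have "\<exists>F :: 'a list \<Rightarrow> real. (\<forall>w. 0 \<le> F w \<and> F w \<le> length w) \<and> almost_additive c F \<and>
      (\<forall>n. \<forall>\<omega>\<in>space (\<Omega> n). L (W n \<omega>) / length (W n \<omega>) = F (map (\<lambda>i. X n i \<omega>) [0..<n]) / n)"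
    using assms(3)
  proof
    assume *: "\<forall>n. \<forall>\<omega>\<in>space (\<Omega> n). generated_left_to_right (\<lambda>i. X n i \<omega>) n (W n \<omega>)"
    have "length (W n \<omega>) = n \<and> W n \<omega> = map (\<lambda>i. X n i \<omega>) [0..<n]" if "\<omega> \<in> space (\<Omega> n)" for n \<omega>
      using * that by (auto simp: generated_left_to_right_def intro!: nth_equalityI)
    then show ?thesis
      using L by (intro exI[of _ L]) auto
  next
    assume *: "\<forall>n. \<forall>\<omega>\<in>space (\<Omega> n). generated_right_to_left (\<lambda>i. X n i \<omega>) n (W n \<omega>)"
    have "length (W n \<omega>) = n \<and> W n \<omega> = rev (map (\<lambda>i. X n i \<omega>) [0..<n])" if "\<omega> \<in> space (\<Omega> n)" for n \<omega>
    proof -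
      have W: "length (W n \<omega>) = n" "\<And>k. k < n \<Longrightarrow> W n \<omega> ! (n - 1 - k) = X n k \<omega>"
        using * that by (auto simp: generated_right_to_left_def)
      have "rev (W n \<omega>) = map (\<lambda>i. X n i \<omega>) [0..<n]"
        by (rule nth_equalityI) (use W in \<open>auto simp: rev_nth\<close>)
      then show ?thesis
        using W(1) by (metis rev_rev_ident)
    qed
    then show ?thesis
      using L almost_additive_rev[OF L(1)] L(3)[of "rev _"]
      by (intro exI[of _ "\<lambda>w. L (rev w)"]) auto
  qed
  then obtain F :: "'a list \<Rightarrow> real" where F: "\<And>w. 0 \<le> F w" "\<And>w. F w \<le> length w" "almost_additive c F"
    "\<And>n \<omega>. \<omega> \<in> space (\<Omega> n) \<Longrightarrow> L (W n \<omega>) / length (W n \<omega>) = F (map (\<lambda>i. X n i \<omega>) [0..<n]) / n"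
    by blast
  have "{\<omega> \<in> space (\<Omega> n). \<bar>real (length_is_iter k (W n \<omega>)) / real (length (W n \<omega>)) - \<gamma>\<bar> \<ge> e} =
      {\<omega> \<in> space (\<Omega> n). \<bar>F (map (\<lambda>i. X n i \<omega>) [0..<n]) / n - \<gamma>\<bar> \<ge> e}" for n \<gamma> e
    using F(4) by (auto simp: L_def)
  then show "\<exists>(\<gamma>::real) (\<epsilon> :: nat \<Rightarrow> real). \<epsilon> \<longlonglongrightarrow> 0 \<and>
      (\<forall>n. \<P>(\<omega> in \<Omega> n. \<bar>real (length_is_iter k (W n \<omega>)) / real (length (W n \<omega>)) - \<gamma>\<bar> \<ge> \<epsilon> n) \<le> \<epsilon> n)"
    using almost_additive_law_of_large_numbers[OF assms(1,2) F(1-3)] by simp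
qed

end
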